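(* Let $\Theta,\Lambda,\Psi\in H^\infty(\mathcal{L}(\mathcal{H}))$ be $\Gamma$-symmetric inner functions such that $\Theta=\Lambda\Psi$. Then the operator $$C_{\Lambda,\Psi}:K_\Theta=K_\Lambda\oplus\Lambda K_\Psi\to K_\Theta=K_\Lambda\oplus\Lambda K_\Psi$$ defined by $$C_{\Lambda,\Psi}=C_\Lambda\oplus\Lambda C_\Psi\Lambda^*=\begin{bmatrix}C_\Lambda&0\\0&\Lambda C_\Psi\Lambda^*\end{bmatrix}$$ is a conjugation on $K_\Theta$.
   Context: $\mathcal{H}$ is a finite-dimensional complex Hilbert space and $\mathcal{L}(\mathcal{H})$ is the algebra of linear operators on it. $\mathbb{T}$ is the unit circle with normalized Lebesgue measure, $L^2(\mathcal{H})$ is the space of square-integrable $\mathcal{H}$-valued functions on $\mathbb{T}$, and $H^2(\mathcal{H})\subset L^2(\mathcal{H})$ is the Hardy space (vanishing negative Fourier coefficients). $H^\infty(\mathcal{L}(\mathcal{H}))$ is the space of bounded analytic $\mathcal{L}(\mathcal{H})$-valued functions on the unit disk $\mathbb{D}$, identified with their boundary functions on $\mathbb{T}$. An inner function is a $\Theta\in H^\infty(\mathcal{L}(\mathcal{H}))$ whose boundary values $\Theta(z)$ are unitary for a.e. $z\in\mathbb{T}$. Its model space is $K_\Theta=H^2(\mathcal{H})\ominus\Theta H^2(\mathcal{H})$. For a bounded operator-valued function $F$, $Ff$ denotes the pointwise product $z\mapsto F(z)f(z)$, the same letter is used for the multiplication operator, and $F^*(z)=F(z)^*$ a.e. on $\mathbb{T}$.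 A conjugation on a Hilbert space $\mathcal{K}$ is an antilinear map $C:\mathcal{K}\to\mathcal{K}$ with $C^2=I$ and $\langle Cf,Cg\rangle=\langle g,f\rangle$ for all $f,g\in\mathcal{K}$. $\Gamma$ is a fixed conjugation on $\mathcal{H}$. A function $\Phi$ is $\Gamma$-symmetric if $\Gamma\Phi(z)\Gamma=\Phi(z)^*$ for a.e. $z\in\mathbb{T}$. For a $\Gamma$-symmetric inner function $\Theta$, the map $(C_\Theta f)(z)=\Theta(z)\,\overline{z}\,\Gamma(f(z))$ (a.e. on $\mathbb{T}$) is a conjugation on $L^2(\mathcal{H})$ with $C_\Theta(K_\Theta)=K_\Theta$; $C_\Theta$ also denotes its restriction to $K_\Theta$. When $\Theta=\Lambda\Psi$ with inner $\Theta,\Lambda,\Psi$, one has the orthogonal decomposition $K_\Theta=K_\Lambda\oplus\Lambda K_\Psi$. *)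

theory Defs
  imports "HOL-Analysis.Analysis"
begin

section \<open>Complex inner product spaces\<close>

class complex_vector = real_vector +
  fixes scaleC :: "complex \<Rightarrow> 'a \<Rightarrow> 'a" (infixr "*\<^sub>C" 75)
  assumes scaleC_add_right: "a *\<^sub>C (x + y) = a *\<^sub>C x + a *\<^sub>C y"
    and scaleC_add_left: "(a + b) *\<^sub>C x = a *\<^sub>C x + b *\<^sub>C x"
    and scaleC_scaleC: "a *\<^sub>C b *\<^sub>C x = (a * b) *\<^sub>C x"
    and scaleC_of_real: "complex_of_real r *\<^sub>C x = r *\<^sub>R x"

text \<open>The complex inner product is linear in the first argument; its real part is the
  real inner product. A finite-dimensional complex Hilbert space is a type of sort
  \<open>{complex_inner, euclidean_space}\<close>.\<close>

class complex_inner = complex_vector + real_inner +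
  fixes cinner :: "'a \<Rightarrow> 'a \<Rightarrow> complex"
  assumes cinner_commute: "cinner x y = cnj (cinner y x)"
    and cinner_add_left: "cinner (x + y) z = cinner x z + cinner y z"
    and cinner_scaleC_left: "cinner (a *\<^sub>C x) y = a * cinner x y"
    and Re_cinner: "Re (cinner x y) = inner x y"

lemma cinner_add_right: "cinner x (y + z) = cinner x y + cinner x z"
  by (metis cinner_add_left cinner_commute complex_cnj_add)

lemma cinner_scaleC_right: "cinner x (a *\<^sub>C y) = cnj a * cinner x y"
  by (metis cinner_commute cinner_scaleC_left complex_cnj_mult)

lemma norm_scaleC: "norm (a *\<^sub>C x) = cmod a * norm (x :: 'a :: complex_inner)"
proof -
  have "cinner x x \<in> \<real>"
    by (metis cinner_commute Reals_cnj_iff)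
  then have xx: "cinner x x = of_real (inner x x)"
    by (metis Re_cinner of_real_Re)
  have "cinner (a *\<^sub>C x) (a *\<^sub>C x) = of_real ((cmod a)\<^sup>2 * inner x x)"
    using complex_norm_square [of a]
    by (simp add: cinner_scaleC_left cinner_scaleC_right xx)
  then have "inner (a *\<^sub>C x) (a *\<^sub>C x) = (cmod a)\<^sup>2 * inner x x"
    by (metis Re_cinner Re_complex_of_real)
  then show ?thesis
    by (simp add: norm_eq_sqrt_inner real_sqrt_mult)
qed

lemma cmod_cinner_le: "cmod (cinner x y) \<le> norm x * norm (y :: 'a :: complex_inner)"
proof (cases "cinner x y = 0")
  case False
  define c where "c = cinner x y"
  define a where "a = cnj c / cmod c"
  have c: "c \<noteq> 0" using False by (simp add: c_def)
  have "a * c = cmod c"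
    using c complex_norm_square [of c] by (simp add: a_def power2_eq_square field_simps)
  then have "cmod c = Re (cinner (a *\<^sub>C x) y)"
    by (simp add: cinner_scaleC_left c_def)
  also have "\<dots> \<le> norm (a *\<^sub>C x) * norm y"
    by (simp add: Re_cinner norm_cauchy_schwarz)
  also have "\<dots> = norm x * norm y"
    using c by (simp add: norm_scaleC a_def norm_divide)
  finally show ?thesis by (simp add: c_def)
qed simp

lemma bounded_bilinear_cinner:
  "bounded_bilinear (cinner :: 'a \<Rightarrow> 'a :: complex_inner \<Rightarrow> complex)"
proof
  show "\<exists>K. \<forall>a b :: 'a. norm (cinner a b) \<le> norm a * norm b * K"
    by (rule exI [of _ 1]) (simp add: cmod_cinner_le)
  show "cinner (r *\<^sub>R a) b = r *\<^sub>R cinner a b" for a b :: 'a and r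
    by (metis cinner_scaleC_left scaleC_of_real scaleR_conv_of_real)
  show "cinner a (r *\<^sub>R b) = r *\<^sub>R cinner a b" for a b :: 'a and r
    by (metis cinner_scaleC_right complex_cnj_complex_of_real scaleC_of_real scaleR_conv_of_real)
qed (simp_all add: cinner_add_left cinner_add_right)

lemma bounded_bilinear_scaleC:
  "bounded_bilinear (scaleC :: complex \<Rightarrow> 'a \<Rightarrow> 'a :: complex_inner)"
proof
  show "\<exists>K. \<forall>a (b :: 'a). norm (a *\<^sub>C b) \<le> norm a * norm b * K"
    by (rule exI [of _ 1]) (simp add: norm_scaleC)
  show "(r *\<^sub>R a) *\<^sub>C b = r *\<^sub>R a *\<^sub>C b" for a and b :: 'a and r
    by (metis scaleC_of_real scaleC_scaleC scaleR_conv_of_real)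
  show "a *\<^sub>C r *\<^sub>R b = r *\<^sub>R a *\<^sub>C b" for a and b :: 'a and r
    by (metis mult.commute scaleC_of_real scaleC_scaleC)
qed (simp_all add: scaleC_add_left scaleC_add_right)

instantiation complex :: complex_inner
begin
definition scaleC_complex :: "complex \<Rightarrow> complex \<Rightarrow> complex" where
  "scaleC_complex a x = a * x"
definition cinner_complex :: "complex \<Rightarrow> complex \<Rightarrow> complex" where
  "cinner_complex x y = x * cnj y"
instance
  by standard (auto simp: scaleC_complex_def cinner_complex_def algebra_simps
      scaleR_conv_of_real inner_complex_def)
end

instantiation vec :: (complex_inner, finite) complex_inner
begin
definition scaleC_vec :: "complex \<Rightarrow> 'a ^ 'b \<Rightarrow> 'a ^ 'b" where
  "scaleC_vec a x = (\<chi> i. a *\<^sub>C x $ i)"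
definition cinner_vec :: "'a ^ 'b \<Rightarrow> 'a ^ 'b \<Rightarrow> complex" where
  "cinner_vec x y = (\<Sum>i\<in>UNIV. cinner (x $ i) (y $ i))"
instance
proof
  show "cinner x y = cnj (cinner y x)" for x y :: "'a ^ 'b"
    by (simp add: cinner_vec_def cnj_sum cinner_commute [symmetric])
qed (auto simp: scaleC_vec_def cinner_vec_def vec_eq_iff scaleC_add_left scaleC_add_right
    scaleC_scaleC scaleC_of_real cinner_add_left cinner_scaleC_left Re_cinner inner_vec_def
    sum.distrib sum_distrib_left)
end

instantiation blinfun :: (real_normed_vector, complex_inner) complex_vector
begin
lift_definition scaleC_blinfun :: "complex \<Rightarrow> ('a \<Rightarrow>\<^sub>L 'b) \<Rightarrow> ('a \<Rightarrow>\<^sub>L 'b)"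
  is "\<lambda>a A x. a *\<^sub>C A x"
  by (rule bounded_bilinear.bounded_linear_right [OF bounded_bilinear_scaleC,
        THEN bounded_linear_compose])
instance
  by standard (transfer, simp add: scaleC_add_left scaleC_add_right scaleC_scaleC scaleC_of_real)+
end

definition conjugation_on :: "'a set \<Rightarrow> ('a :: complex_inner \<Rightarrow> 'a) \<Rightarrow> bool" where
  "conjugation_on K C \<longleftrightarrow>
    (\<forall>f\<in>K. C f \<in> K) \<and>
    (\<forall>f\<in>K. \<forall>g\<in>K. \<forall>a b. C (a *\<^sub>C f + b *\<^sub>C g) = cnj a *\<^sub>C C f + cnj b *\<^sub>C C g) \<and>
    (\<forall>f\<in>K. C (C f) = f) \<and>
    (\<forall>f\<in>K. \<forall>g\<in>K. cinner (C f) (C g) = cinner g f)"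

definition orth_minus :: "'a set \<Rightarrow> 'a set \<Rightarrow> 'a :: complex_inner set" (infixl "\<ominus>" 65) where
  "M \<ominus> N = {f \<in> M. \<forall>g\<in>N. cinner f g = 0}"

text \<open>The operator acting as \<open>A\<close> on \<open>M\<close> and as \<open>B\<close> on \<open>N\<close>; it is meaningful on
  \<open>M + N\<close> when this sum is direct.\<close>

definition direct_sum_map ::
  "'a set \<Rightarrow> 'a set \<Rightarrow> ('a \<Rightarrow> 'a) \<Rightarrow> ('a \<Rightarrow> 'a) \<Rightarrow> 'a :: complex_inner \<Rightarrow> 'a" where
  "direct_sum_map M N A B f = (THE h. \<exists>u\<in>M. \<exists>v\<in>N. f = u + v \<and> h = A u + B v)"


section \<open>Operators on \<open>\<H>\<close>\<close>

text \<open>\<open>'h \<Rightarrow>\<^sub>L 'h\<close> consists of the real-linear operators; \<open>\<L>(\<H>)\<close> is cut out by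
  \<open>complex_linear\<close>.\<close>

definition complex_linear :: "('h :: complex_inner \<Rightarrow>\<^sub>L 'h) \<Rightarrow> bool" where
  "complex_linear A \<longleftrightarrow> (\<forall>a x. A (a *\<^sub>C x) = a *\<^sub>C A x)"

definition adj :: "('h :: complex_inner \<Rightarrow>\<^sub>L 'h) \<Rightarrow> ('h \<Rightarrow>\<^sub>L 'h)" where
  "adj A = (THE B. \<forall>x y. cinner (blinfun_apply A x) y = cinner x (blinfun_apply B y))"

definition unitary :: "('h :: complex_inner \<Rightarrow>\<^sub>L 'h) \<Rightarrow> bool" where
  "unitary A \<longleftrightarrow> adj A o\<^sub>L A = id_blinfun \<and> A o\<^sub>L adj A = id_blinfun"


section \<open>The space \<open>L\<^sup>2(\<H>)\<close>\<close>

text \<open>The completion makes every function that is almost everywhere equal to a measurable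
  one measurable.\<close>

definition circle_measure :: "complex measure" where
  "circle_measure =
    completion (distr (uniform_measure lborel {0..2*pi}) (restrict_space borel (sphere 0 1)) cis)"

definition square_integrable ::
  "(complex \<Rightarrow> 'h :: {complex_inner, euclidean_space}) \<Rightarrow> bool" where
  "square_integrable f \<longleftrightarrow>
    f \<in> borel_measurable circle_measure \<and> integrable circle_measure (\<lambda>z. (norm (f z))\<^sup>2)"

definition L2_eq ::
  "(complex \<Rightarrow> 'h :: {complex_inner, euclidean_space}) \<Rightarrow> (complex \<Rightarrow> 'h) \<Rightarrow> bool" where
  "L2_eq f g \<longleftrightarrow>
    square_integrable f \<and> square_integrable g \<and> (AE z in circle_measure. f z = g z)"

lemma square_integrable_zero: "square_integrable (\<lambda>_. 0)"
  by (simp add: square_integrable_def)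

lemma square_integrable_add:
  assumes "square_integrable f" "square_integrable g"
  shows "square_integrable (\<lambda>z. f z + g z)"
proof -
  have [measurable]: "f \<in> borel_measurable circle_measure" "g \<in> borel_measurable circle_measure"
    using assms by (auto simp: square_integrable_def)
  have "integrable circle_measure (\<lambda>z. 2 * ((norm (f z))\<^sup>2 + (norm (g z))\<^sup>2))"
    using assms by (auto simp: square_integrable_def)
  then have "integrable circle_measure (\<lambda>z. (norm (f z + g z))\<^sup>2)"
  proof (rule Bochner_Integration.integrable_bound)
    have "(norm (x + y))\<^sup>2 \<le> 2 * ((norm x)\<^sup>2 + (norm y)\<^sup>2)" for x y :: 'a
    proof -
      have "(norm (x + y))\<^sup>2 \<le> (norm x + norm y)\<^sup>2"
        by (intro power_mono norm_triangle_ineq norm_ge_zero)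
      also have "\<dots> \<le> 2 * ((norm x)\<^sup>2 + (norm y)\<^sup>2)"
        using sum_squares_bound [of "norm x" "norm y"] by (simp add: power2_sum)
      finally show ?thesis .
    qed
    then show "AE z in circle_measure. norm ((norm (f z + g z))\<^sup>2)
        \<le> norm (2 * ((norm (f z))\<^sup>2 + (norm (g z))\<^sup>2))"
      by (auto intro: order_trans [OF _ abs_ge_self])
  qed measurable
  then show ?thesis by (simp add: square_integrable_def)
qed

lemma square_integrable_scaleC:
  fixes f :: "complex \<Rightarrow> 'h :: {complex_inner, euclidean_space}"
  assumes "square_integrable f"
  shows "square_integrable (\<lambda>z. a *\<^sub>C f z)"
proof -
  have "(\<lambda>z. a *\<^sub>C f z) \<in> borel_measurable circle_measure"
  proof (rule measurable_compose [where g = "scaleC a"])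
    show "f \<in> borel_measurable circle_measure"
      using assms by (simp add: square_integrable_def)
    show "(scaleC a :: 'h \<Rightarrow> 'h) \<in> borel_measurable borel"
      by (intro borel_measurable_continuous_onI linear_continuous_on
          bounded_bilinear.bounded_linear_right [OF bounded_bilinear_scaleC])
  qed
  then show ?thesis
    using assms by (simp add: square_integrable_def norm_scaleC power_mult_distrib)
qed

lemma square_integrable_scaleR:
  "square_integrable f \<Longrightarrow> square_integrable (\<lambda>z. r *\<^sub>R f z)"
  using square_integrable_scaleC [of f "of_real r"] by (simp add: scaleC_of_real)

lemma square_integrable_uminus:
  "square_integrable f \<Longrightarrow> square_integrable (\<lambda>z. - f z)"
  using square_integrable_scaleR [of f "-1"] by simp

lemma borel_measurable_cinner:
  fixes f g :: "'b \<Rightarrow> 'h :: {complex_inner, euclidean_space}"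
  assumes "f \<in> borel_measurable M" "g \<in> borel_measurable M"
  shows "(\<lambda>z. cinner (f z) (g z)) \<in> borel_measurable M"
  by (rule borel_measurable_continuous_Pair [OF assms, where H = cinner])
    (intro bounded_bilinear.continuous_on [OF bounded_bilinear_cinner] continuous_intros)

lemma integrable_cinner:
  assumes "square_integrable f" "square_integrable g"
  shows "integrable circle_measure (\<lambda>z. cinner (f z) (g z))"
proof -
  have "integrable circle_measure (\<lambda>z. (norm (f z))\<^sup>2 + (norm (g z))\<^sup>2)"
    using assms by (auto simp: square_integrable_def)
  then show ?thesis
  proof (rule Bochner_Integration.integrable_bound)
    show "(\<lambda>z. cinner (f z) (g z)) \<in> borel_measurable circle_measure"
      using assms by (auto simp: square_integrable_def intro: borel_measurable_cinner)
    have "cmod (cinner x y) \<le> norm ((norm x)\<^sup>2 + (norm y)\<^sup>2)" for x y :: 'a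
    proof -
      have "0 \<le> norm x * norm y" by simp
      then show ?thesis
        using cmod_cinner_le [of x y] sum_squares_bound [of "norm x" "norm y"]
        unfolding real_norm_def by linarith
    qed
    then show "AE z in circle_measure. norm (cinner (f z) (g z))
        \<le> norm ((norm (f z))\<^sup>2 + (norm (g z))\<^sup>2)"
      by simp
  qed
qed

quotient_type (overloaded) 'h L2 =
  "complex \<Rightarrow> 'h :: {complex_inner, euclidean_space}" / partial: L2_eq
proof (rule part_equivpI)
  show "\<exists>f :: complex \<Rightarrow> 'h. L2_eq f f"
    using square_integrable_zero by (auto simp: L2_eq_def)
  show "symp (L2_eq :: (complex \<Rightarrow> 'h) \<Rightarrow> _)"
    by (auto simp: symp_def L2_eq_def elim: AE_mp)
  show "transp (L2_eq :: (complex \<Rightarrow> 'h) \<Rightarrow> _)"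
    by (auto simp: transp_def L2_eq_def elim: AE_mp)
qed

instantiation L2 :: ("{complex_inner, euclidean_space}") complex_inner
begin

lift_definition zero_L2 :: "'a L2" is "\<lambda>_. 0"
  by (simp add: L2_eq_def square_integrable_zero)

lift_definition plus_L2 :: "'a L2 \<Rightarrow> 'a L2 \<Rightarrow> 'a L2" is "\<lambda>f g z. f z + g z"
  by (auto simp: L2_eq_def square_integrable_add)

lift_definition uminus_L2 :: "'a L2 \<Rightarrow> 'a L2" is "\<lambda>f z. - f z"
  by (auto simp: L2_eq_def square_integrable_uminus)

definition minus_L2 :: "'a L2 \<Rightarrow> 'a L2 \<Rightarrow> 'a L2" where
  "minus_L2 f g = f + - g"

lift_definition scaleR_L2 :: "real \<Rightarrow> 'a L2 \<Rightarrow> 'a L2" is "\<lambda>r f z. r *\<^sub>R f z"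
  by (auto simp: L2_eq_def square_integrable_scaleR)

lift_definition scaleC_L2 :: "complex \<Rightarrow> 'a L2 \<Rightarrow> 'a L2" is "\<lambda>a f z. a *\<^sub>C f z"
  by (auto simp: L2_eq_def square_integrable_scaleC)

lift_definition cinner_L2 :: "'a L2 \<Rightarrow> 'a L2 \<Rightarrow> complex"
  is "\<lambda>f g. LINT z|circle_measure. cinner (f z) (g z)"
  by (rule integral_cong_AE)
    (auto simp: L2_eq_def square_integrable_def intro: borel_measurable_cinner)

definition inner_L2 :: "'a L2 \<Rightarrow> 'a L2 \<Rightarrow> real" where
  "inner_L2 f g = Re (cinner f g)"

definition norm_L2 :: "'a L2 \<Rightarrow> real" where
  "norm_L2 f = sqrt (inner f f)"

definition sgn_L2 :: "'a L2 \<Rightarrow> 'a L2" where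
  "sgn_L2 f = inverse (norm f) *\<^sub>R f"

definition dist_L2 :: "'a L2 \<Rightarrow> 'a L2 \<Rightarrow> real" where
  "dist_L2 f g = norm (f - g)"

definition uniformity_L2 :: "('a L2 \<times> 'a L2) filter" where
  "uniformity_L2 = (INF e\<in>{0<..}. principal {(x, y). dist x y < e})"

definition open_L2 :: "'a L2 set \<Rightarrow> bool" where
  "open_L2 U \<longleftrightarrow> (\<forall>x\<in>U. eventually (\<lambda>(x', y). x' = x \<longrightarrow> y \<in> U) uniformity)"

instance
proof
  fix f g h :: "'a L2" and a b :: complex and r s :: real
  show "f + g + h = f + (g + h)"
    by transfer (auto simp: L2_eq_def add.assoc intro!: square_integrable_add)
  show "f + g = g + f"
    by transfer (auto simp: L2_eq_def add.commute intro!: square_integrable_add)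
  show "0 + f = f"
    by transfer (auto simp: L2_eq_def)
  show "- f + f = 0"
    by transfer (auto simp: L2_eq_def square_integrable_zero)
  show "f - g = f + - g"
    by (simp add: minus_L2_def)
  show "r *\<^sub>R (f + g) = r *\<^sub>R f + r *\<^sub>R g"
    by transfer (auto simp: L2_eq_def scaleR_add_right
        intro!: square_integrable_add square_integrable_scaleR)
  show "(r + s) *\<^sub>R f = r *\<^sub>R f + s *\<^sub>R f"
    by transfer (auto simp: L2_eq_def scaleR_add_left
        intro!: square_integrable_add square_integrable_scaleR)
  show "r *\<^sub>R s *\<^sub>R f = (r * s) *\<^sub>R f"
    by transfer (auto simp: L2_eq_def square_integrable_scaleR)
  show "1 *\<^sub>R f = f"
    by transfer (auto simp: L2_eq_def)
  show "a *\<^sub>C (f + g) = a *\<^sub>C f + a *\<^sub>C g"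
    by transfer (auto simp: L2_eq_def scaleC_add_right
        intro!: square_integrable_add square_integrable_scaleC)
  show "(a + b) *\<^sub>C f = a *\<^sub>C f + b *\<^sub>C f"
    by transfer (auto simp: L2_eq_def scaleC_add_left
        intro!: square_integrable_add square_integrable_scaleC)
  show "a *\<^sub>C b *\<^sub>C f = (a * b) *\<^sub>C f"
    by transfer (auto simp: L2_eq_def scaleC_scaleC square_integrable_scaleC)
  show "complex_of_real r *\<^sub>C f = r *\<^sub>R f"
    by transfer (auto simp: L2_eq_def scaleC_of_real square_integrable_scaleR)
  show comm: "cinner f g = cnj (cinner g f)" for f g :: "'a L2"
  proof transfer
    fix u v :: "complex \<Rightarrow> 'a"
    have "(\<lambda>z. cinner (u z) (v z)) = (\<lambda>z. cnj (cinner (v z) (u z)))"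
      by (rule ext) (rule cinner_commute)
    then show "(LINT z|circle_measure. cinner (u z) (v z))
        = cnj (LINT z|circle_measure. cinner (v z) (u z))"
      by simp
  qed
  show add: "cinner (f + g) h = cinner f h + cinner g h" for f g h :: "'a L2"
    by transfer (simp add: L2_eq_def cinner_add_left integrable_cinner)
  show scale: "cinner (a *\<^sub>C f) g = a * cinner f g" for a and f g :: "'a L2"
    by transfer (simp add: L2_eq_def cinner_scaleC_left)
  show "Re (cinner f g) = inner f g"
    by (simp add: inner_L2_def)
  show "inner f g = inner g f"
    unfolding inner_L2_def by (subst comm) simp
  show "inner (f + g) h = inner f h + inner g h"
    by (simp add: inner_L2_def add)
  have "r *\<^sub>R f = of_real r *\<^sub>C f"
    by transfer (auto simp: L2_eq_def scaleC_of_real square_integrable_scaleR)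
  then show "inner (r *\<^sub>R f) g = r * inner f g"
    by (simp add: inner_L2_def scale)
  have Re_self: "Re (LINT z|circle_measure. cinner (u z) (u z))
      = (LINT z|circle_measure. (norm (u z))\<^sup>2)"
    if "square_integrable u" for u :: "complex \<Rightarrow> 'a"
    by (subst integral_Re [symmetric])
      (simp_all add: integrable_cinner that Re_cinner power2_norm_eq_inner)
  show "0 \<le> inner f f"
    unfolding inner_L2_def by transfer (simp add: L2_eq_def Re_self)
  show "inner f f = 0 \<longleftrightarrow> f = 0"
    unfolding inner_L2_def
  proof transfer
    fix u :: "complex \<Rightarrow> 'a"
    assume "L2_eq u u"
    then have u: "square_integrable u" by (simp add: L2_eq_def)
    then have "integrable circle_measure (\<lambda>z. (norm (u z))\<^sup>2)"
      by (simp add: square_integrable_def)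
    then show "Re (LINT z|circle_measure. cinner (u z) (u z)) = 0 \<longleftrightarrow> L2_eq u (\<lambda>_. 0)"
      using u by (simp add: Re_self L2_eq_def square_integrable_zero integral_nonneg_eq_0_iff_AE)
  qed
  show "norm f = sqrt (inner f f)"
    by (simp add: norm_L2_def)
  show "sgn f = inverse (norm f) *\<^sub>R f"
    by (simp add: sgn_L2_def)
  show "dist f g = norm (f - g)"
    by (simp add: dist_L2_def)
  show "uniformity = (INF e\<in>{0<..}. principal {(x, y :: 'a L2). dist x y < e})"
    by (simp add: uniformity_L2_def)
  show "open U \<longleftrightarrow> (\<forall>x\<in>U. \<forall>\<^sub>F (x', y) in uniformity. x' = x \<longrightarrow> y \<in> U)" for U :: "'a L2 set"
    by (simp add: open_L2_def)
qed

end

text \<open>\<open>pointwise_map T\<close> sends the class of \<open>f\<close> to the class of \<open>z \<mapsto> T z (f z)\<close>. The latter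
  does not depend on the representative, but it is meaningful only if \<open>z \<mapsto> T z (f z)\<close>
  is again square-integrable.\<close>

definition pointwise_map ::
  "(complex \<Rightarrow> 'h \<Rightarrow> 'h) \<Rightarrow> 'h :: {complex_inner, euclidean_space} L2 \<Rightarrow> 'h L2" where
  "pointwise_map T f = abs_L2 (\<lambda>z. T z (rep_L2 f z))"

definition mult_op ::
  "(complex \<Rightarrow> 'h \<Rightarrow>\<^sub>L 'h) \<Rightarrow> 'h :: {complex_inner, euclidean_space} L2 \<Rightarrow> 'h L2" where
  "mult_op F = pointwise_map (\<lambda>z. blinfun_apply (F z))"

definition fourier_coeff :: "'h :: {complex_inner, euclidean_space} L2 \<Rightarrow> int \<Rightarrow> 'h" where
  "fourier_coeff f n = (LINT z|circle_measure. (z powi (- n)) *\<^sub>C rep_L2 f z)"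

definition H2 :: "'h :: {complex_inner, euclidean_space} L2 set" where
  "H2 = {f. \<forall>n<0. fourier_coeff f n = 0}"


section \<open>Inner functions and model spaces\<close>

text \<open>An element of \<open>H\<^sup>\<infinity>(\<L>(\<H>))\<close> and its boundary function are given by one function
  on the closed unit disk: analytic and bounded on the open disk, and equal at almost every
  point of the circle to the radial limit (which exists a.e. by Fatou's theorem). The
  analyticity is complex differentiability in operator norm.\<close>

definition Hinf :: "(complex \<Rightarrow> 'h :: {complex_inner, euclidean_space} \<Rightarrow>\<^sub>L 'h) set" where
  "Hinf = {F.
    (\<forall>z\<in>ball 0 1. complex_linear (F z)) \<and>
    (\<forall>z\<in>ball 0 1. \<exists>D. (F has_derivative (\<lambda>h. h *\<^sub>C D)) (at z)) \<and>
    bounded (F ` ball 0 1) \<and>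
    (AE z in circle_measure. ((\<lambda>r. F (r *\<^sub>R z)) \<longlongrightarrow> F z) (at_left (1::real)))}"

definition inner_function ::
  "(complex \<Rightarrow> 'h :: {complex_inner, euclidean_space} \<Rightarrow>\<^sub>L 'h) \<Rightarrow> bool" where
  "inner_function \<Theta> \<longleftrightarrow> \<Theta> \<in> Hinf \<and> (AE z in circle_measure. unitary (\<Theta> z))"

definition Gamma_symmetric ::
  "('h \<Rightarrow> 'h) \<Rightarrow> (complex \<Rightarrow> 'h :: {complex_inner, euclidean_space} \<Rightarrow>\<^sub>L 'h) \<Rightarrow> bool" where
  "Gamma_symmetric \<Gamma> \<Phi> \<longleftrightarrow>
    (AE z in circle_measure. \<forall>x. \<Gamma> (\<Phi> z (\<Gamma> x)) = adj (\<Phi> z) x)"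

definition model_space ::
  "(complex \<Rightarrow> 'h :: {complex_inner, euclidean_space} \<Rightarrow>\<^sub>L 'h) \<Rightarrow> 'h L2 set" where
  "model_space \<Theta> = H2 \<ominus> mult_op \<Theta> ` H2"

definition model_conj ::
  "('h \<Rightarrow> 'h) \<Rightarrow> (complex \<Rightarrow> 'h :: {complex_inner, euclidean_space} \<Rightarrow>\<^sub>L 'h) \<Rightarrow>
    'h L2 \<Rightarrow> 'h L2" where
  "model_conj \<Gamma> \<Theta> = pointwise_map (\<lambda>z x. \<Theta> z (cnj z *\<^sub>C \<Gamma> x))"

definition factor_conj ::
  "('h \<Rightarrow> 'h) \<Rightarrow> (complex \<Rightarrow> 'h :: {complex_inner, euclidean_space} \<Rightarrow>\<^sub>L 'h) \<Rightarrow>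
    (complex \<Rightarrow> 'h \<Rightarrow>\<^sub>L 'h) \<Rightarrow> 'h L2 \<Rightarrow> 'h L2" where
  "factor_conj \<Gamma> \<Lambda> \<Psi> =
    direct_sum_map (model_space \<Lambda>) (mult_op \<Lambda> ` model_space \<Psi>)
      (model_conj \<Gamma> \<Lambda>)
      (mult_op \<Lambda> \<circ> model_conj \<Gamma> \<Psi> \<circ> mult_op (\<lambda>z. adj (\<Lambda> z)))"

end

theory Submission
  imports Defs "HOL-Complex_Analysis.Cauchy_Integral_Formula"
begin

text \<open>Pointwise, \<open>C\<^sub>\<Lambda>\<close> is an antilinear involutive isometry because \<open>\<Lambda>(z)\<close> is unitary and
  \<open>\<Gamma>\<Lambda>(z)\<Gamma> = \<Lambda>(z)\<^sup>*\<close>. Comparing with the monomials \<open>z\<^sup>n y\<close> one gets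
  \<open>\<langle>C\<^sub>\<Lambda> f, z\<^sup>n y\<rangle> = \<langle>\<Lambda> z\<^bsup>-n-1\<^esup> \<Gamma>y, f\<rangle>\<close>, which vanishes for \<open>n < 0\<close> if \<open>f \<bottom> \<Lambda>H\<^sup>2\<close>, and
  \<open>\<langle>C\<^sub>\<Lambda> f, \<Lambda> z\<^sup>n y\<rangle> = \<langle>z\<^bsup>-n-1\<^esup> \<Gamma>y, f\<rangle>\<close>, which vanishes for \<open>n \<ge> 0\<close> if \<open>f \<in> H\<^sup>2\<close>; as polynomials are
  dense in \<open>H\<^sup>2\<close>, \<open>C\<^sub>\<Lambda>\<close> preserves \<open>K\<^sub>\<Lambda>\<close>. The summands of \<open>f \<in> K\<^sub>\<Theta>\<close> are \<open>\<Lambda>w\<close> and \<open>f - \<Lambda>w\<close>, where \<open>w\<close> is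
  the orthogonal projection of \<open>\<Lambda>\<^sup>*f\<close> onto \<open>H\<^sup>2\<close>; that \<open>w \<bottom> \<Psi>H\<^sup>2\<close> is \<open>\<Theta> = \<Lambda>\<Psi>\<close> and
  \<open>f \<bottom> \<Theta>H\<^sup>2\<close>. The conjugation on \<open>K\<^sub>\<Theta>\<close> is then an orthogonal direct sum of conjugations.

  The analytic input is the completeness of \<open>L\<^sup>2\<close> (for the projection), the uniqueness of Fourier
  coefficients (for the density) and \<open>\<Lambda>H\<^sup>2 \<subseteq> H\<^sup>2\<close>. For the last, the dilation \<open>\<Lambda>(rz)\<close> is an
  absolutely convergent power series in \<open>z\<close>, so it maps \<open>H\<^sup>2\<close> to \<open>H\<^sup>2\<close>; let \<open>r \<rightarrow> 1\<close>.\<close>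

section \<open>Complex inner products and operators\<close>

interpretation cinner: bounded_bilinear "cinner :: 'a :: complex_inner \<Rightarrow> 'a \<Rightarrow> complex"
  by (rule bounded_bilinear_cinner)

interpretation scaleC: bounded_bilinear "scaleC :: complex \<Rightarrow> 'a \<Rightarrow> 'a :: complex_inner"
  by (rule bounded_bilinear_scaleC)

declare cinner.zero_left [simp] cinner.zero_right [simp] scaleC.zero_left [simp] scaleC.zero_right [simp]

lemma cinner_self: "cinner x x = of_real ((norm (x :: 'a :: complex_inner))\<^sup>2)"
proof -
  have "cinner x x \<in> \<real>"
    by (metis cinner_commute Reals_cnj_iff)
  then show ?thesis
    by (metis Re_cinner of_real_Re power2_norm_eq_inner)
qed

lemma cinner_eqI:
  fixes x y :: "'a :: complex_inner"
  assumes "\<And>z. cinner x z = cinner y z"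
  shows "x = y"
proof -
  have "cinner (x - y) (x - y) = 0"
    using assms[of "x - y"] by (simp add: cinner.diff_left)
  then show ?thesis
    by (simp add: cinner_self)
qed

lemma scaleC_one: "1 *\<^sub>C x = x"
  using scaleC_of_real[of 1 x] by simp

lemma scaleC_minus_one: "(- 1) *\<^sub>C x = - x"
  using scaleC_of_real[of "- 1" x] by simp

text \<open>Multiplying by \<open>\<i>\<close> turns the imaginary part into a real part, so an
  identity for the real inner product extends to \<open>cinner\<close> once it is also known at
  \<open>\<i> *\<^sub>C x\<close>.\<close>

lemma Im_cinner: "Im (cinner x y) = - inner (\<i> *\<^sub>C x) y"
  by (metis Re_cinner Re_i_times cinner_scaleC_left minus_minus)

text \<open>\<open>adj\<close> is a definite description, so existence and uniqueness are at stake.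
  The real adjoint exists in finite dimension; since \<open>A\<close> commutes with multiplication
  by \<open>\<i>\<close>, it is also the adjoint for \<open>cinner\<close>.\<close>

lemma cinner_adj:
  fixes A :: "'h :: {complex_inner, euclidean_space} \<Rightarrow>\<^sub>L 'h"
  assumes "complex_linear A"
  shows "cinner (A x) y = cinner x (adj A y)"
proof -
  have lin: "linear (blinfun_apply A)"
    by (rule bounded_linear.linear [OF blinfun.bounded_linear_right])
  define B where "B = Blinfun (adjoint (blinfun_apply A))"
  have B: "blinfun_apply B = adjoint (blinfun_apply A)"
    unfolding B_def by (rule bounded_linear_Blinfun_apply)
      (intro linear_conv_bounded_linear[THEN iffD1] adjoint_linear lin)
  have re: "inner (A x) y = inner x (B y)" for x y
    unfolding B by (simp add: adjoint_works[OF lin])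
  have ci: "cinner (A x) y = cinner x (B y)" for x y
  proof (rule complex_eqI)
    show "Re (cinner (A x) y) = Re (cinner x (B y))"
      by (simp add: Re_cinner re)
    have "A (\<i> *\<^sub>C x) = \<i> *\<^sub>C A x"
      using assms by (simp add: complex_linear_def)
    then show "Im (cinner (A x) y) = Im (cinner x (B y))"
      by (metis Im_cinner re)
  qed
  have "adj A = B"
    unfolding adj_def
  proof (rule the_equality)
    show "\<forall>x y. cinner (blinfun_apply A x) y = cinner x (blinfun_apply B y)"
      by (simp add: ci)
    fix C assume C: "\<forall>x y. cinner (blinfun_apply A x) y = cinner x (blinfun_apply C y)"
    show "C = B"
    proof (rule blinfun_eqI, rule cinner_eqI)
      fix y z
      show "cinner (C y) z = cinner (B y) z"
        by (metis C ci cinner_commute)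
    qed
  qed
  with ci show ?thesis by simp
qed

lemma unitary_adj_apply: "unitary A \<Longrightarrow> adj A (A x) = x"
  unfolding unitary_def by (metis blinfun_apply_blinfun_compose blinfun_apply_id_blinfun id_apply)

lemma unitary_apply_adj: "unitary A \<Longrightarrow> A (adj A x) = x"
  unfolding unitary_def by (metis blinfun_apply_blinfun_compose blinfun_apply_id_blinfun id_apply)

lemma unitary_norm:
  fixes A :: "'h :: {complex_inner, euclidean_space} \<Rightarrow>\<^sub>L 'h"
  assumes "complex_linear A" "unitary A"
  shows "norm (A x) = norm x"
proof -
  have "cinner (A x) (A x) = cinner x x"
    using assms by (simp add: cinner_adj unitary_adj_apply)
  then have "(norm (A x))\<^sup>2 = (norm x)\<^sup>2"
    unfolding cinner_self of_real_eq_iff .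
  then show ?thesis by simp
qed

section \<open>Elementary properties of conjugations\<close>

lemma conjugation_onD:
  assumes "conjugation_on K C" "f \<in> K" "g \<in> K"
  shows "C f \<in> K" "C (a *\<^sub>C f + b *\<^sub>C g) = cnj a *\<^sub>C C f + cnj b *\<^sub>C C g"
    "C (C f) = f" "cinner (C f) (C g) = cinner g f"
  using assms unfolding conjugation_on_def by blast+

locale conjugation =
  fixes \<Gamma> :: "'h :: complex_inner \<Rightarrow> 'h"
  assumes conj: "conjugation_on UNIV \<Gamma>"
begin

lemma add: "\<Gamma> (x + y) = \<Gamma> x + \<Gamma> y"
  using conjugation_onD(2)[OF conj UNIV_I UNIV_I, of 1 x 1 y] by (simp add: scaleC_one)

lemma scale: "\<Gamma> (a *\<^sub>C x) = cnj a *\<^sub>C \<Gamma> x"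
  using conjugation_onD(2)[OF conj UNIV_I UNIV_I, of a x 0 x] by (simp add: scaleC.zero_left)

lemma idem: "\<Gamma> (\<Gamma> x) = x"
  using conjugation_onD(3)[OF conj UNIV_I UNIV_I] by blast

lemma cinner: "cinner (\<Gamma> x) (\<Gamma> y) = cinner y x"
  using conjugation_onD(4)[OF conj UNIV_I UNIV_I] by blast

lemma norm: "norm (\<Gamma> x) = norm x"
proof -
  have "(norm (\<Gamma> x))\<^sup>2 = (norm x)\<^sup>2"
    using cinner[of x x] unfolding cinner_self of_real_eq_iff .
  then show ?thesis by simp
qed

text \<open>Conjugation of scalars fixes the reals, so an antilinear map is real linear. This gives
  continuity, and with it measurability, of \<open>\<Gamma>\<close>.\<close>

lemma bounded_linear: "bounded_linear \<Gamma>"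
proof (rule bounded_linear_intro[where K = 1])
  show "\<Gamma> (r *\<^sub>R x) = r *\<^sub>R \<Gamma> x" for r x
    by (metis scale scaleC_of_real complex_cnj_complex_of_real)
qed (simp_all add: add norm)

end


section \<open>The circle measure and \<open>L\<^sup>2\<close> representatives\<close>

lemma measurable_cis:
  "cis \<in> measurable (uniform_measure lborel {0..2*pi}) (restrict_space borel (sphere 0 1))"
proof (rule measurable_restrict_space2)
  have "cis \<in> borel_measurable borel"
    by (intro borel_measurable_continuous_onI continuous_intros)
  then show "cis \<in> borel_measurable (uniform_measure lborel {0..2*pi})"
    by (simp cong: measurable_cong_sets)
qed simp

lemma space_circle_measure [simp]: "space circle_measure = sphere 0 1"
  by (simp add: circle_measure_def space_restrict_space)

lemma finite_measure_circle: "finite_measure circle_measure"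
proof
  let ?U = "uniform_measure lborel {0..2*pi}"
  let ?M = "distr ?U (restrict_space borel (sphere 0 1)) cis"
  have "emeasure circle_measure (space circle_measure) = emeasure ?M (space ?M)"
    unfolding circle_measure_def
    by (metis emeasure_completion main_part sets.top sets_completionI_sets space_completion)
  also have "emeasure ?M (space ?M) = emeasure ?U (cis -` space ?M \<inter> space ?U)"
    by (rule emeasure_distr[OF measurable_cis]) (metis sets.top sets_distr)
  also have "cis -` space ?M \<inter> space ?U = UNIV"
    by (auto simp: space_restrict_space)
  also have "emeasure ?U UNIV = emeasure lborel {0..2*pi} / emeasure lborel {0..2*pi}"
    by (subst emeasure_uniform_measure) auto
  also have "\<dots> \<noteq> \<infinity>"
    by (simp add: divide_ennreal)
  finally show "emeasure circle_measure (space circle_measure) \<noteq> \<infinity>" .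
qed

interpretation circle: finite_measure circle_measure
  by (rule finite_measure_circle)

interpretation circle: complete_measure circle_measure
  unfolding circle_measure_def by (rule completion.complete_measure_axioms)

lemma borel_measurable_circle_continuous:
  "continuous_on (sphere 0 1) f \<Longrightarrow> f \<in> borel_measurable circle_measure"
  unfolding circle_measure_def
  by (intro measurable_completion)
    (simp add: measurable_cong_sets[OF sets_distr refl] borel_measurable_continuous_on_restrict)

text \<open>Completeness of the measure enters here. It makes boundary values and adjoints
  measurable, which are only identified almost everywhere.\<close>

lemma borel_measurable_circle_AE:
  assumes f: "f \<in> borel_measurable circle_measure"
    and ae: "AE z in circle_measure. f z = g z"
  shows "g \<in> borel_measurable circle_measure"
proof (rule borel_measurableI)
  fix S :: "'a set" assume "open S"
  then have "f -` S \<inter> space circle_measure \<in> sets circle_measure"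
    using f by (intro measurable_sets) auto
  moreover have "AE z in circle_measure. z \<in> f -` S \<inter> space circle_measure \<longleftrightarrow> z \<in> g -` S \<inter> space circle_measure"
    using ae by eventually_elim auto
  ultimately show "g -` S \<inter> space circle_measure \<in> sets circle_measure"
    using circle.in_sets_AE by blast
qed

lemma borel_measurable_scaleC:
  fixes f :: "'b \<Rightarrow> 'h :: {complex_inner, euclidean_space}"
  assumes "a \<in> borel_measurable M" "f \<in> borel_measurable M"
  shows "(\<lambda>z. a z *\<^sub>C f z) \<in> borel_measurable M"
  by (rule borel_measurable_continuous_Pair [OF assms, where H = scaleC])
    (intro scaleC.continuous_on continuous_intros)

lemma AE_circle_norm: "AE z in circle_measure. cmod z = 1"
  using AE_space[of circle_measure] by eventually_elim simp

section \<open>Representatives of classes in \<open>L2\<close>\<close>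

lemma square_integrable_rep: "square_integrable (rep_L2 f)"
  using Quotient3_rep_reflp[OF Quotient3_L2, of f] by (simp add: L2_eq_def)

lemma rep_measurable: "rep_L2 f \<in> borel_measurable circle_measure"
  using square_integrable_rep by (auto simp: square_integrable_def)

lemma rep_abs_L2:
  assumes "square_integrable u"
  shows "AE z in circle_measure. rep_L2 (abs_L2 u) z = u z"
  using rep_abs_rsp_left[OF Quotient3_L2, of u u] assms by (auto simp: L2_eq_def)

lemma L2_eqI:
  assumes "AE z in circle_measure. rep_L2 f z = rep_L2 g z"
  shows "f = g"
  using Quotient3_rel_rep[OF Quotient3_L2, of f g] assms
  by (simp add: L2_eq_def square_integrable_rep)

lemma rep_zero: "AE z in circle_measure. rep_L2 0 z = 0"
  unfolding zero_L2_def by (rule rep_abs_L2[OF square_integrable_zero])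

lemma rep_add: "AE z in circle_measure. rep_L2 (f + g) z = rep_L2 f z + rep_L2 g z"
  unfolding plus_L2_def map_fun_def comp_def id_def
  by (rule rep_abs_L2[OF square_integrable_add[OF square_integrable_rep square_integrable_rep]])

lemma rep_scaleC: "AE z in circle_measure. rep_L2 (a *\<^sub>C f) z = a *\<^sub>C rep_L2 f z"
  unfolding scaleC_L2_def map_fun_def comp_def id_def
  by (rule rep_abs_L2[OF square_integrable_scaleC[OF square_integrable_rep]])

lemma rep_diff: "AE z in circle_measure. rep_L2 (f - g) z = rep_L2 f z - rep_L2 g z"
proof -
  have "f - g = f + (- 1) *\<^sub>C g"
    unfolding scaleC_minus_one by simp
  moreover have "AE z in circle_measure. rep_L2 (f + (- 1) *\<^sub>C g) z = rep_L2 f z - rep_L2 g z"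
    using rep_add[of f "(- 1) *\<^sub>C g"] rep_scaleC[of "- 1" g]
    by eventually_elim (simp add: scaleC_minus_one)
  ultimately show ?thesis by metis
qed

lemma cinner_rep: "cinner f g = (LINT z|circle_measure. cinner (rep_L2 f z) (rep_L2 g z))"
  unfolding cinner_L2_def map_fun_def comp_def id_def ..

lemma integrable_norm2_rep: "integrable circle_measure (\<lambda>z. (norm (rep_L2 f z))\<^sup>2)"
  using square_integrable_rep by (auto simp: square_integrable_def)

lemma norm2_rep: "(norm f)\<^sup>2 = (LINT z|circle_measure. (norm (rep_L2 f z))\<^sup>2)"
proof -
  have "of_real ((norm f)\<^sup>2) = (LINT z|circle_measure. complex_of_real ((norm (rep_L2 f z))\<^sup>2))"
    using cinner_rep[of f f] unfolding cinner_self .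
  then show ?thesis
    unfolding integral_complex_of_real of_real_eq_iff .
qed

lemma cinner_cong_AE:
  assumes "AE z in circle_measure. cinner (rep_L2 f z) (rep_L2 g z) = cinner (rep_L2 f' z) (rep_L2 g' z)"
  shows "cinner f g = cinner f' g'"
  unfolding cinner_rep
  by (rule integral_cong_AE) (use assms in \<open>auto intro: borel_measurable_cinner rep_measurable\<close>)

text \<open>The bound \<open>t \<le> 1 + t\<^sup>2\<close> suffices, as constants are integrable for
  a finite measure.\<close>

lemma square_integrable_imp_integrable:
  assumes "square_integrable f"
  shows "integrable circle_measure f"
proof (rule Bochner_Integration.integrable_bound[where f = "\<lambda>z. 1 + (norm (f z))\<^sup>2"])
  show "AE z in circle_measure. norm (f z) \<le> norm (1 + (norm (f z))\<^sup>2)"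
  proof (rule AE_I2)
    fix z
    have "norm (f z) \<le> 1 + (norm (f z))\<^sup>2"
      using sum_squares_bound[of "norm (f z)" 1] norm_ge_zero[of "f z"]
      by (simp del: norm_ge_zero)
    then show "norm (f z) \<le> norm (1 + (norm (f z))\<^sup>2)"
      by simp
  qed
qed (use assms in \<open>auto simp: square_integrable_def\<close>)


section \<open>Pointwise isometries\<close>

text \<open>The condition under which \<open>pointwise_map\<close> can be evaluated almost
  everywhere. It covers linear and antilinear fibres at once and is stable under
  composition.\<close>

definition pw_isometry :: "(complex \<Rightarrow> 'h \<Rightarrow> 'h :: {complex_inner, euclidean_space}) \<Rightarrow> bool" where
  "pw_isometry T \<longleftrightarrow>
    (\<forall>f\<in>borel_measurable circle_measure. (\<lambda>z. T z (f z)) \<in> borel_measurable circle_measure) \<and>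
    (AE z in circle_measure. \<forall>x. norm (T z x) = norm x)"

lemma square_integrable_cong_norm:
  assumes "square_integrable f" and g: "g \<in> borel_measurable circle_measure"
    and ae: "AE z in circle_measure. norm (g z) = norm (f z)"
  shows "square_integrable g"
proof -
  have int: "integrable circle_measure (\<lambda>z. (norm (f z))\<^sup>2)"
    using assms(1) unfolding square_integrable_def by blast
  have "integrable circle_measure (\<lambda>z. (norm (g z))\<^sup>2)"
  proof (rule Bochner_Integration.integrable_bound[OF int])
    show "AE z in circle_measure. norm ((norm (g z))\<^sup>2) \<le> norm ((norm (f z))\<^sup>2)"
      using ae by eventually_elim simp
    show "(\<lambda>z. (norm (g z))\<^sup>2) \<in> borel_measurable circle_measure"
      by (rule borel_measurable_power[OF measurable_compose[OF g borel_measurable_norm]])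
  qed
  with g show ?thesis
    unfolding square_integrable_def by blast
qed

lemma pw_isometryI:
  assumes "\<And>f. f \<in> borel_measurable circle_measure \<Longrightarrow> (\<lambda>z. T z (f z)) \<in> borel_measurable circle_measure"
    and "AE z in circle_measure. \<forall>x. norm (T z x) = norm x"
  shows "pw_isometry T"
  using assms unfolding pw_isometry_def by blast

lemma
  assumes "pw_isometry T"
  shows pw_isometry_measurable: "f \<in> borel_measurable circle_measure \<Longrightarrow> (\<lambda>z. T z (f z)) \<in> borel_measurable circle_measure"
    and pw_isometry_norm: "AE z in circle_measure. \<forall>x. norm (T z x) = norm x"
  using assms unfolding pw_isometry_def by blast+

lemma pw_isometry_square_integrable:
  assumes "pw_isometry T" "square_integrable f"
  shows "square_integrable (\<lambda>z. T z (f z))"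
proof (rule square_integrable_cong_norm[OF assms(2)])
  show "(\<lambda>z. T z (f z)) \<in> borel_measurable circle_measure"
    using assms(2) by (intro pw_isometry_measurable[OF assms(1)]) (simp add: square_integrable_def)
  show "AE z in circle_measure. norm (T z (f z)) = norm (f z)"
    using pw_isometry_norm[OF assms(1)] by eventually_elim simp
qed

lemma rep_pointwise_map:
  assumes "pw_isometry T"
  shows "AE z in circle_measure. rep_L2 (pointwise_map T f) z = T z (rep_L2 f z)"
  unfolding pointwise_map_def
  by (rule rep_abs_L2[OF pw_isometry_square_integrable[OF assms square_integrable_rep]])

lemma pw_isometry_compose:
  assumes "pw_isometry S" "pw_isometry T"
  shows "pw_isometry (\<lambda>z x. S z (T z x))"
proof (rule pw_isometryI)
  show "(\<lambda>z. S z (T z (f z))) \<in> borel_measurable circle_measure"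
    if "f \<in> borel_measurable circle_measure" for f
    by (rule pw_isometry_measurable[OF assms(1) pw_isometry_measurable[OF assms(2) that]])
  show "AE z in circle_measure. \<forall>x. norm (S z (T z x)) = norm x"
    using pw_isometry_norm[OF assms(1)] pw_isometry_norm[OF assms(2)]
    by eventually_elim simp
qed

lemma pw_isometry_cong_AE:
  assumes "pw_isometry S" and ae: "AE z in circle_measure. \<forall>x. S z x = T z x"
  shows "pw_isometry T"
proof (rule pw_isometryI)
  show "(\<lambda>z. T z (f z)) \<in> borel_measurable circle_measure"
    if "f \<in> borel_measurable circle_measure" for f
    by (rule borel_measurable_circle_AE[OF pw_isometry_measurable[OF assms(1) that]])
      (use ae in eventually_elim, simp)
  show "AE z in circle_measure. \<forall>x. norm (T z x) = norm x"
    using pw_isometry_norm[OF assms(1)] ae by eventually_elim simp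
qed

lemma pw_isometry_conjugation:
  fixes \<Gamma> :: "'h :: {complex_inner, euclidean_space} \<Rightarrow> 'h"
  assumes "conjugation \<Gamma>"
  shows "pw_isometry (\<lambda>z. \<Gamma>)"
proof -
  interpret C: conjugation \<Gamma> by fact
  have m: "\<Gamma> \<in> borel_measurable borel"
    by (intro borel_measurable_continuous_onI linear_continuous_on C.bounded_linear)
  show ?thesis
  proof (rule pw_isometryI)
    show "(\<lambda>z. \<Gamma> (f z)) \<in> borel_measurable circle_measure"
      if "f \<in> borel_measurable circle_measure" for f
      by (rule measurable_compose[OF that m])
    show "AE z in circle_measure. \<forall>x. norm (\<Gamma> x) = norm x"
      by (intro AE_I2 allI C.norm)
  qed
qed

lemma pw_isometry_scaleC:
  assumes "continuous_on (sphere 0 1) a" "\<And>z. cmod z = 1 \<Longrightarrow> cmod (a z) = 1"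
  shows "pw_isometry (\<lambda>z. scaleC (a z))"
proof (rule pw_isometryI)
  show "(\<lambda>z. a z *\<^sub>C f z) \<in> borel_measurable circle_measure"
    if "f \<in> borel_measurable circle_measure" for f :: "complex \<Rightarrow> 'a"
    by (rule borel_measurable_scaleC[OF borel_measurable_circle_continuous[OF assms(1)] that])
  show "AE z in circle_measure. \<forall>x :: 'a. norm (a z *\<^sub>C x) = norm x"
    using AE_circle_norm
  proof eventually_elim
    case (elim z)
    show ?case unfolding norm_scaleC assms(2)[OF elim] by simp
  qed
qed


section \<open>Completeness of \<open>L\<^sup>2\<close> and orthogonal projections\<close>

text \<open>A minimizing sequence is Cauchy by the parallelogram law, and minimality of the distance
  at its limit forces orthogonality.\<close>

lemma complete_subspace_projection:
  fixes S :: "'a :: real_inner set"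
  assumes S: "complete S" "subspace S"
  obtains p where "p \<in> S" "\<And>s. s \<in> S \<Longrightarrow> inner (x - p) s = 0"
proof -
  define D where "D = (INF s\<in>S. (norm (x - s))\<^sup>2)"
  have S0: "S \<noteq> {}"
    using subspace_0[OF S(2)] by blast
  have bdd: "bdd_below ((\<lambda>s. (norm (x - s))\<^sup>2) ` S)"
    by (rule bdd_belowI2[of _ 0]) simp
  have D_le: "D \<le> (norm (x - s))\<^sup>2" if "s \<in> S" for s
    unfolding D_def by (rule cINF_lower[OF bdd that])
  have "\<exists>s\<in>S. (norm (x - s))\<^sup>2 < D + 1 / (real n + 1)" for n :: nat
    using cINF_less_iff[OF S0 bdd, of "D + 1 / (real n + 1)"] by (simp add: D_def)
  then obtain s where sS: "\<And>n. s n \<in> S" and s: "\<And>n :: nat. (norm (x - s n))\<^sup>2 < D + 1 / (real n + 1)"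
    by metis
  \<comment> \<open>The midpoint lies in \<open>S\<close>, so its squared distance from
    \<open>x\<close> is at least \<open>D\<close>; the parallelogram law then leaves at most
    \<open>4 / (real N + 1)\<close> for the squared gap.\<close>
  have close: "(dist (s m) (s n))\<^sup>2 \<le> 4 / (real N + 1)" if "m \<ge> N" "n \<ge> N" for m n N
  proof -
    have "(1/2) *\<^sub>R (s m + s n) \<in> S"
      by (intro subspace_mul subspace_add S sS)
    then have "4 * D \<le> 4 * (norm (x - (1/2) *\<^sub>R (s m + s n)))\<^sup>2"
      using D_le by simp
    also have "\<dots> = (norm (2 *\<^sub>R (x - (1/2) *\<^sub>R (s m + s n))))\<^sup>2"
      by (simp add: power_mult_distrib)
    also have "2 *\<^sub>R (x - (1/2) *\<^sub>R (s m + s n)) = (x - s m) + (x - s n)"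
      by (simp add: scaleR_diff_right scaleR_2)
    finally have "4 * D \<le> (norm ((x - s m) + (x - s n)))\<^sup>2" .
    moreover have "(norm ((x - s m) + (x - s n)))\<^sup>2 + (norm ((x - s m) - (x - s n)))\<^sup>2
        = 2 * (norm (x - s m))\<^sup>2 + 2 * (norm (x - s n))\<^sup>2"
      unfolding power2_norm_eq_inner by (simp add: inner_simps inner_commute)
    moreover have "norm ((x - s m) - (x - s n)) = dist (s m) (s n)"
      by (simp add: dist_norm norm_minus_commute)
    moreover have "1 / (real m + 1) \<le> 1 / (real N + 1)" "1 / (real n + 1) \<le> 1 / (real N + 1)"
      using that by (auto simp: field_simps)
    ultimately show ?thesis
      using s[of m] s[of n] by simp
  qed
  have "Cauchy s"
  proof (rule metric_CauchyI)
    fix e :: real assume e: "0 < e"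
    obtain N :: nat where "4 / e\<^sup>2 < real N"
      using reals_Archimedean2 by blast
    then have N: "4 / (real N + 1) < e\<^sup>2"
      using e by (simp add: field_simps) (smt (verit) zero_less_power)
    have "dist (s m) (s n) < e" if "m \<ge> N" "n \<ge> N" for m n
      using close[OF that] N e by (meson le_less_trans less_imp_le power_less_imp_less_base)
    then show "\<exists>M. \<forall>m\<ge>M. \<forall>n\<ge>M. dist (s m) (s n) < e" by blast
  qed
  then obtain p where p: "p \<in> S" "s \<longlonglongrightarrow> p"
    using S(1) sS unfolding complete_def by blast
  have "(\<lambda>n. (norm (x - s n))\<^sup>2) \<longlonglongrightarrow> (norm (x - p))\<^sup>2"
    by (intro tendsto_intros p)
  moreover have "(\<lambda>n. D + 1 / (real n + 1)) \<longlonglongrightarrow> D + 0"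
    using LIMSEQ_inverse_real_of_nat by (intro tendsto_intros) (simp add: inverse_eq_divide add.commute)
  ultimately have "(norm (x - p))\<^sup>2 \<le> D + 0"
    by (rule LIMSEQ_le) (use s in \<open>auto intro: less_imp_le\<close>)
  then have pD: "(norm (x - p))\<^sup>2 = D"
    using D_le[OF p(1)] by simp
  have "inner (x - p) s = 0" if "s \<in> S" for s
  proof (cases "s = 0")
    case False
    \<comment> \<open>\<open>t *\<^sub>R s\<close> is the projection of \<open>x - p\<close> onto
      the line of \<open>s\<close>, the correction that would reduce the distance most.\<close>
    define t where "t = inner (x - p) s / (norm s)\<^sup>2"
    have "p + t *\<^sub>R s \<in> S"
      by (intro subspace_mul subspace_add S p that)
    then have "(norm (x - p))\<^sup>2 \<le> (norm (x - (p + t *\<^sub>R s)))\<^sup>2"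
      unfolding pD by (rule D_le)
    also have "x - (p + t *\<^sub>R s) = (x - p) - t *\<^sub>R s" by simp
    also have "(norm ((x - p) - t *\<^sub>R s))\<^sup>2 = (norm (x - p))\<^sup>2 - 2 * t * inner (x - p) s + t\<^sup>2 * (norm s)\<^sup>2"
      unfolding power2_norm_eq_inner
      by (simp add: inner_diff_left inner_diff_right inner_commute power2_eq_square algebra_simps)
    also have "t\<^sup>2 * (norm s)\<^sup>2 = t * inner (x - p) s"
      using False by (simp add: t_def power2_eq_square)
    finally have "t * inner (x - p) s \<le> 0" by simp
    then have "(inner (x - p) s)\<^sup>2 / (norm s)\<^sup>2 \<le> 0"
      by (simp add: t_def power2_eq_square)
    then show ?thesis
      using False by (simp add: divide_le_0_iff)
  qed simp
  with p(1) that show ?thesis by blast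
qed

text \<open>From \<open>(x - a)\<^sup>2 / a \<ge> 0\<close>. The weight \<open>a\<close> stays free
  so that it can match the size of \<open>f\<close>: an L2 bound \<open>a\<close> then yields an L1
  bound of order \<open>a\<close>.\<close>

lemma integral_norm_rep_le:
  assumes "a > 0"
  shows "(LINT z|circle_measure. norm (rep_L2 f z))
    \<le> ((norm f)\<^sup>2 / a + a * measure circle_measure (space circle_measure)) / 2"
proof -
  have "(LINT z|circle_measure. norm (rep_L2 f z))
      \<le> (LINT z|circle_measure. ((norm (rep_L2 f z))\<^sup>2 / a + a) / 2)"
  proof (rule integral_mono_AE)
    show "integrable circle_measure (\<lambda>z. norm (rep_L2 f z))"
      by (intro integrable_norm square_integrable_imp_integrable square_integrable_rep)
    show "integrable circle_measure (\<lambda>z. ((norm (rep_L2 f z))\<^sup>2 / a + a) / 2)"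
      by (intro integrable_divide Bochner_Integration.integrable_add integrable_norm2_rep) simp
    have "x \<le> (x\<^sup>2 / a + a) / 2" for x :: real
    proof -
      have "0 \<le> (x - a)\<^sup>2 / a" using assms by simp
      also have "\<dots> = x\<^sup>2 / a - 2 * x + a"
        using assms by (simp add: power2_eq_square field_simps)
      finally show ?thesis by simp
    qed
    then show "AE z in circle_measure. norm (rep_L2 f z) \<le> ((norm (rep_L2 f z))\<^sup>2 / a + a) / 2"
      by blast
  qed
  also have "\<dots> = ((norm f)\<^sup>2 / a + a * measure circle_measure (space circle_measure)) / 2"
    using integrable_norm2_rep[of f] by (simp add: norm2_rep mult.commute)
  finally show ?thesis .
qed

text \<open>The increments have summable L1 norms, so the sum of their pointwise norms is finite
  almost everywhere, and the telescoping sums converge there.\<close>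

lemma AE_convergent_rep:
  fixes Y :: "nat \<Rightarrow> 'h :: {complex_inner, euclidean_space} L2"
  assumes Y: "\<And>k. norm (Y (Suc k) - Y k) \<le> (1/2)^k"
  shows "AE z in circle_measure. convergent (\<lambda>k. rep_L2 (Y k) z)"
proof -
  define h where "h k z = norm (rep_L2 (Y (Suc k) - Y k) z)" for k z
  define C where "C = (1 + measure circle_measure (space circle_measure)) / 2"
  have C0: "0 \<le> C" by (simp add: C_def)
  have h_int: "integrable circle_measure (h k)" for k
    unfolding h_def by (intro integrable_norm square_integrable_imp_integrable square_integrable_rep)
  then have [measurable]: "h k \<in> borel_measurable circle_measure" for k
    by (rule borel_measurable_integrable)
  have h_le: "integral\<^sup>L circle_measure (h k) \<le> C * (1/2)^k" for k
  proof -
    have "(norm (Y (Suc k) - Y k))\<^sup>2 \<le> ((1/2)^k)\<^sup>2"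
      using Y by (intro power_mono) auto
    then have "(norm (Y (Suc k) - Y k))\<^sup>2 / (1/2)^k \<le> (1/2)^k"
      by (simp add: power2_eq_square divide_le_eq)
    then show ?thesis
      using integral_norm_rep_le[of "(1/2)^k" "Y (Suc k) - Y k"] unfolding h_def C_def
      by (simp add: algebra_simps)
  qed
  have "(\<integral>\<^sup>+z. (\<Sum>k. ennreal (h k z)) \<partial>circle_measure) = (\<Sum>k. \<integral>\<^sup>+z. ennreal (h k z) \<partial>circle_measure)"
    by (rule nn_integral_suminf) measurable
  also have "\<dots> = (\<Sum>k. ennreal (integral\<^sup>L circle_measure (h k)))"
    by (intro suminf_cong nn_integral_eq_integral h_int) (simp add: h_def)
  also have "\<dots> \<le> (\<Sum>k. ennreal (C * (1/2)^k))"
    by (intro suminf_le ennreal_leI h_le summableI)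
  also have "\<dots> = ennreal (\<Sum>k. C * (1/2)^k)"
    by (rule suminf_ennreal2) (auto simp: C0)
  finally have "(\<integral>\<^sup>+z. (\<Sum>k. ennreal (h k z)) \<partial>circle_measure) \<noteq> \<infinity>"
    by (auto simp: top_unique)
  then have "AE z in circle_measure. (\<Sum>k. ennreal (h k z)) \<noteq> \<infinity>"
    by (intro nn_integral_PInf_AE) measurable
  moreover have "AE z in circle_measure. \<forall>k. rep_L2 (Y (Suc k) - Y k) z = rep_L2 (Y (Suc k)) z - rep_L2 (Y k) z"
    by (intro AE_all_countable[THEN iffD2] allI rep_diff)
  ultimately show ?thesis
  proof eventually_elim
    case (elim z)
    have "summable (\<lambda>k. h k z)"
      using elim(1) by (intro summable_suminf_not_top) (auto simp: h_def)
    then have "summable (\<lambda>k. rep_L2 (Y (Suc k)) z - rep_L2 (Y k) z)"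
      unfolding h_def elim(2)[rule_format] by (rule summable_norm_cancel)
    then have "convergent (\<lambda>n. \<Sum>k<n. rep_L2 (Y (Suc k)) z - rep_L2 (Y k) z)"
      by (simp add: summable_iff_convergent)
    then have "convergent (\<lambda>n. rep_L2 (Y n) z - rep_L2 (Y 0) z)"
      by (subst (asm) sum_lessThan_telescope)
    then show ?case
      using convergent_add[OF _ convergent_const[of "rep_L2 (Y 0) z"]] by fastforce
  qed
qed

lemma Cauchy_geometric_subseq:
  assumes "Cauchy X"
  obtains M :: "nat \<Rightarrow> nat" where "strict_mono M"
    "\<And>j k. j \<ge> k \<Longrightarrow> dist (X (M j)) (X (M k)) \<le> (1/2)^k"
proof -
  have "\<exists>N. \<forall>m\<ge>N. \<forall>n\<ge>N. dist (X m) (X n) < (1/2)^k" for k :: nat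
    using metric_CauchyD[OF assms, of "(1/2)^k"] by simp
  then obtain N where N: "\<And>k m n :: nat. m \<ge> N k \<Longrightarrow> n \<ge> N k \<Longrightarrow> dist (X m) (X n) < (1/2)^k"
    by metis
  \<comment> \<open>The sum of the \<open>Suc (N i)\<close> dominates \<open>N k\<close> and is
    strictly increasing, whatever \<open>N\<close> is.\<close>
  define M where "M k = (\<Sum>i\<le>k. Suc (N i))" for k
  have M: "strict_mono M"
    by (rule strict_monoI_Suc) (simp add: M_def)
  have "N k \<le> M k" for k
    by (cases k) (simp_all add: M_def)
  moreover have "M k \<le> M j" if "k \<le> j" for j k
    using M that by (simp add: strict_mono_less_eq)
  ultimately have "dist (X (M j)) (X (M k)) \<le> (1/2)^k" if "j \<ge> k" for j k
    using that by (meson N less_imp_le order_trans)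
  with M that show ?thesis by blast
qed

text \<open>Riesz-Fischer: a geometrically fast subsequence converges almost everywhere, and Fatou's
  lemma turns this into convergence in norm. A Cauchy sequence with a convergent subsequence
  converges.\<close>

lemma Cauchy_L2_convergent:
  fixes X :: "nat \<Rightarrow> 'h :: {complex_inner, euclidean_space} L2"
  assumes "Cauchy X"
  shows "convergent X"
proof -
  obtain M where M: "strict_mono M" "\<And>j k. j \<ge> k \<Longrightarrow> dist (X (M j)) (X (M k)) \<le> (1/2)^k"
    using Cauchy_geometric_subseq[OF assms] by blast
  define Y where "Y = X \<circ> M"
  have Y: "norm (Y j - Y k) \<le> (1/2)^k" if "j \<ge> k" for j k
    using M(2)[OF that] by (simp add: Y_def dist_norm)
  \<comment> \<open>Where the sequence diverges the value of \<open>lim\<close> is unspecified;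
    \<open>conv\<close> below confines this to a null set.\<close>
  define g where "g z = lim (\<lambda>k. rep_L2 (Y k) z)" for z
  have rm [measurable]: "rep_L2 f \<in> borel_measurable circle_measure" for f :: "'h L2"
    by (rule rep_measurable)
  have gm [measurable]: "g \<in> borel_measurable circle_measure"
    unfolding g_def by (rule borel_measurable_lim_metric) measurable
  have conv: "AE z in circle_measure. (\<lambda>j. rep_L2 (Y j) z) \<longlonglongrightarrow> g z"
    using AE_convergent_rep[of Y, OF Y[OF le_SucI[OF order_refl]]]
    by eventually_elim (simp add: g_def convergent_LIMSEQ_iff)
  \<comment> \<open>Here \<open>k\<close> is fixed and \<open>j\<close> tends to infinity: the bound
    for \<open>Y j - Y k\<close> passes to \<open>g - rep_L2 (Y k)\<close>.\<close>
  have fatou: "(\<integral>\<^sup>+z. ennreal ((norm (g z - rep_L2 (Y k) z))\<^sup>2) \<partial>circle_measure) \<le> ennreal (((1/2)^k)\<^sup>2)" for k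
  proof -
    have "(\<integral>\<^sup>+z. ennreal ((norm (g z - rep_L2 (Y k) z))\<^sup>2) \<partial>circle_measure)
        = (\<integral>\<^sup>+z. liminf (\<lambda>j. ennreal ((norm (rep_L2 (Y j) z - rep_L2 (Y k) z))\<^sup>2)) \<partial>circle_measure)"
    proof (rule nn_integral_cong_AE)
      show "AE z in circle_measure. ennreal ((norm (g z - rep_L2 (Y k) z))\<^sup>2)
          = liminf (\<lambda>j. ennreal ((norm (rep_L2 (Y j) z - rep_L2 (Y k) z))\<^sup>2))"
        using conv
      proof eventually_elim
        case (elim z)
        then have "(\<lambda>j. ennreal ((norm (rep_L2 (Y j) z - rep_L2 (Y k) z))\<^sup>2))
            \<longlonglongrightarrow> ennreal ((norm (g z - rep_L2 (Y k) z))\<^sup>2)"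
          by (intro tendsto_ennrealI tendsto_intros)
        then show ?case
          by (intro lim_imp_Liminf[symmetric]) auto
      qed
    qed
    also have "\<dots> \<le> liminf (\<lambda>j. \<integral>\<^sup>+z. ennreal ((norm (rep_L2 (Y j) z - rep_L2 (Y k) z))\<^sup>2) \<partial>circle_measure)"
      by (rule nn_integral_liminf) measurable
    also have "\<dots> \<le> ennreal (((1/2)^k)\<^sup>2)"
    proof (rule Liminf_le)
      have "(\<integral>\<^sup>+z. ennreal ((norm (rep_L2 (Y j) z - rep_L2 (Y k) z))\<^sup>2) \<partial>circle_measure) \<le> ennreal (((1/2)^k)\<^sup>2)"
        if "j \<ge> k" for j
      proof -
        have "(\<integral>\<^sup>+z. ennreal ((norm (rep_L2 (Y j) z - rep_L2 (Y k) z))\<^sup>2) \<partial>circle_measure)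
            = (\<integral>\<^sup>+z. ennreal ((norm (rep_L2 (Y j - Y k) z))\<^sup>2) \<partial>circle_measure)"
          by (rule nn_integral_cong_AE) (use rep_diff[of "Y j" "Y k"] in eventually_elim, simp)
        also have "\<dots> = ennreal ((norm (Y j - Y k))\<^sup>2)"
          by (simp add: nn_integral_eq_integral[OF integrable_norm2_rep] norm2_rep)
        also have "\<dots> \<le> ennreal (((1/2)^k)\<^sup>2)"
          by (intro ennreal_leI power_mono Y that) simp
        finally show ?thesis .
      qed
      then show "\<forall>\<^sub>F j in sequentially.
          (\<integral>\<^sup>+z. ennreal ((norm (rep_L2 (Y j) z - rep_L2 (Y k) z))\<^sup>2) \<partial>circle_measure) \<le> ennreal (((1/2)^k)\<^sup>2)"
        by (auto simp: eventually_sequentially)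
    qed simp
    finally show ?thesis .
  qed
  have diff_int: "integrable circle_measure (\<lambda>z. (norm (g z - rep_L2 (Y k) z))\<^sup>2)" for k
  proof (rule integrableI_bounded)
    have "(\<integral>\<^sup>+z. ennreal (norm ((norm (g z - rep_L2 (Y k) z))\<^sup>2)) \<partial>circle_measure) \<le> ennreal (((1/2)^k)\<^sup>2)"
      using fatou[of k] by simp
    then show "(\<integral>\<^sup>+z. ennreal (norm ((norm (g z - rep_L2 (Y k) z))\<^sup>2)) \<partial>circle_measure) < \<infinity>"
      by (rule le_less_trans) simp
  qed measurable
  have "square_integrable (\<lambda>z. g z - rep_L2 (Y 0) z)"
    using diff_int[of 0] unfolding square_integrable_def by simp
  then have "square_integrable (\<lambda>z. (g z - rep_L2 (Y 0) z) + rep_L2 (Y 0) z)"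
    by (rule square_integrable_add[OF _ square_integrable_rep])
  then have g: "square_integrable g"
    by simp
  define G where "G = abs_L2 g"
  have le: "norm (G - Y k) \<le> (1/2)^k" for k
  proof -
    have "AE z in circle_measure. rep_L2 (G - Y k) z = g z - rep_L2 (Y k) z"
      using rep_diff[of G "Y k"] rep_abs_L2[OF g] unfolding G_def by eventually_elim simp
    then have "(norm (G - Y k))\<^sup>2 = (LINT z|circle_measure. (norm (g z - rep_L2 (Y k) z))\<^sup>2)"
      unfolding norm2_rep
    proof (intro integral_cong_AE)
      assume "AE z in circle_measure. rep_L2 (G - Y k) z = g z - rep_L2 (Y k) z"
      then show "AE z in circle_measure. (norm (rep_L2 (G - Y k) z))\<^sup>2 = (norm (g z - rep_L2 (Y k) z))\<^sup>2"
        by eventually_elim simp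
    qed measurable
    then have "ennreal ((norm (G - Y k))\<^sup>2) \<le> ennreal (((1/2)^k)\<^sup>2)"
      using fatou[of k] by (simp add: nn_integral_eq_integral[OF diff_int])
    then have "(norm (G - Y k))\<^sup>2 \<le> ((1/2)^k)\<^sup>2"
      by (subst (asm) ennreal_le_iff) auto
    then show ?thesis
      by (rule power2_le_imp_le) simp
  qed
  have "(\<lambda>k. Y k - G) \<longlonglongrightarrow> 0"
  proof (rule Lim_null_comparison)
    show "\<forall>\<^sub>F k in sequentially. norm (Y k - G) \<le> (1/2)^k"
      using le by (simp add: norm_minus_commute)
    show "(\<lambda>k. (1/2 :: real)^k) \<longlonglongrightarrow> 0"
      by (rule LIMSEQ_realpow_zero) auto
  qed
  then have "Y \<longlonglongrightarrow> G"
    by (simp add: LIM_zero_iff)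
  then have "X \<longlonglongrightarrow> G"
    unfolding Y_def by (rule Cauchy_converges_subseq[OF assms M(1)])
  then show ?thesis
    by (rule convergentI)
qed

text \<open>With this, the closed subspace \<open>H2\<close> is complete, as the orthogonal
  projection requires.\<close>

instance L2 :: ("{complex_inner, euclidean_space}") complete_space
  by standard (rule Cauchy_L2_convergent)


section \<open>Fourier coefficients and the Hardy space\<close>

text \<open>With \<open>y\<close> running over the whole space, these take the place of an
  orthonormal basis: inner products with them read off the vector-valued Fourier
  coefficients.\<close>

definition monomial :: "int \<Rightarrow> 'h :: {complex_inner, euclidean_space} \<Rightarrow> 'h L2" where
  "monomial n y = abs_L2 (\<lambda>z. (z powi n) *\<^sub>C y)"

lemma continuous_on_circle_powi: "continuous_on (sphere 0 1) (\<lambda>z :: complex. z powi n)"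
  by (intro continuous_intros) auto

lemma cnj_powi_circle:
  assumes "cmod z = 1"
  shows "cnj (z powi n) = z powi (- n)"
proof -
  have "cnj z = inverse z"
    using assms complex_norm_square[of z] by (intro inverse_unique[symmetric]) simp
  then have "cnj (z powi n) = inverse z powi n"
    by simp
  then show ?thesis
    by (simp add: power_int_minus power_int_inverse)
qed

lemma square_integrable_monomial: "square_integrable (\<lambda>z. (z powi n) *\<^sub>C y)"
proof -
  have m: "(\<lambda>z. (z powi n) *\<^sub>C y) \<in> borel_measurable circle_measure"
    by (rule borel_measurable_scaleC[OF borel_measurable_circle_continuous[OF continuous_on_circle_powi]]) simp
  show ?thesis
  proof (rule square_integrable_cong_norm[OF _ m])
    show "square_integrable (\<lambda>_. y)"
      by (simp add: square_integrable_def)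
    show "AE z in circle_measure. norm (z powi n *\<^sub>C y) = norm y"
      using AE_circle_norm by eventually_elim (simp add: norm_scaleC norm_power_int)
  qed
qed

lemma rep_monomial: "AE z in circle_measure. rep_L2 (monomial n y) z = (z powi n) *\<^sub>C y"
  unfolding monomial_def by (rule rep_abs_L2[OF square_integrable_monomial])

lemma integrable_powi_rep: "integrable circle_measure (\<lambda>z. (z powi n) *\<^sub>C rep_L2 f z)"
proof (rule Bochner_Integration.integrable_bound)
  show "integrable circle_measure (rep_L2 f)"
    by (rule square_integrable_imp_integrable[OF square_integrable_rep])
  show "(\<lambda>z. (z powi n) *\<^sub>C rep_L2 f z) \<in> borel_measurable circle_measure"
    by (rule borel_measurable_scaleC[OF borel_measurable_circle_continuous[OF continuous_on_circle_powi]
          rep_measurable])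
  show "AE z in circle_measure. norm ((z powi n) *\<^sub>C rep_L2 f z) \<le> norm (rep_L2 f z)"
    using AE_circle_norm by eventually_elim (simp add: norm_scaleC norm_power_int)
qed

lemma integral_cinner_left:
  assumes "integrable M f"
  shows "(LINT z|M. cinner (f z) y) = cinner (integral\<^sup>L M f) y"
  by (rule integral_bounded_linear[OF cinner.bounded_linear_left assms])

lemma integral_powi_cinner:
  "(LINT z|circle_measure. z powi n * cinner (rep_L2 f z) y) = cinner (fourier_coeff f (- n)) y"
  unfolding fourier_coeff_def minus_minus
  by (subst integral_cinner_left[symmetric, OF integrable_powi_rep]) (simp add: cinner_scaleC_left)

lemma cinner_monomial: "cinner f (monomial n y) = cinner (fourier_coeff f n) y"
proof -
  have "cinner f (monomial n y) = (LINT z|circle_measure. z powi (- n) * cinner (rep_L2 f z) y)"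
    unfolding cinner_rep
  proof (rule integral_cong_AE)
    show "AE z in circle_measure. cinner (rep_L2 f z) (rep_L2 (monomial n y) z)
        = z powi (- n) * cinner (rep_L2 f z) y"
      using rep_monomial[of n y] AE_circle_norm
      by eventually_elim (simp add: cinner_scaleC_right cnj_powi_circle del: complex_cnj_power_int)
    show "(\<lambda>z. z powi (- n) * cinner (rep_L2 f z) y) \<in> borel_measurable circle_measure"
      by (intro borel_measurable_times borel_measurable_cinner rep_measurable
          borel_measurable_circle_continuous continuous_on_circle_powi) simp
  qed (rule borel_measurable_cinner[OF rep_measurable rep_measurable])
  then show ?thesis
    by (simp add: integral_powi_cinner)
qed

lemma fourier_coeff_eq_0_iff: "fourier_coeff f n = 0 \<longleftrightarrow> (\<forall>y. cinner f (monomial n y) = 0)"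
  unfolding cinner_monomial using cinner_eqI[of "fourier_coeff f n" 0] by auto

section \<open>The Hardy space as a closed subspace with orthogonal projection\<close>

lemma H2_iff: "f \<in> H2 \<longleftrightarrow> (\<forall>n<0. \<forall>y. cinner f (monomial n y) = 0)"
  by (simp add: H2_def fourier_coeff_eq_0_iff)

lemma H2_lincomb: "f \<in> H2 \<Longrightarrow> g \<in> H2 \<Longrightarrow> a *\<^sub>C f + b *\<^sub>C g \<in> H2"
  by (simp add: H2_iff cinner_add_left cinner_scaleC_left)

lemma subspace_H2: "subspace H2"
  unfolding subspace_def
proof (intro conjI ballI allI)
  show "x + y \<in> H2" if "x \<in> H2" "y \<in> H2" for x y :: "'a L2"
    using H2_lincomb[OF that, of 1 1] by (simp add: scaleC_one)
  show "c *\<^sub>R x \<in> H2" if "x \<in> H2" for c and x :: "'a L2"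
    using H2_lincomb[OF that that, of "of_real c" 0] by (simp add: scaleC_of_real scaleC.zero_left)
qed (simp add: H2_iff)

lemma closed_H2: "closed H2"
proof -
  have "H2 = (\<Inter>n\<in>{..<0}. \<Inter>y. {f. cinner f (monomial n y) = 0})"
    by (auto simp: H2_iff)
  also have "closed \<dots>"
    by (intro closed_INT ballI closed_Collect_eq continuous_intros
        linear_continuous_on cinner.bounded_linear_left)
  finally show ?thesis .
qed

lemma H2_projection:
  obtains p where "p \<in> H2" "\<And>s. s \<in> H2 \<Longrightarrow> cinner (x - p) s = 0"
proof -
  obtain p where p: "p \<in> H2" "\<And>s. s \<in> H2 \<Longrightarrow> inner (x - p) s = 0"
    using complete_subspace_projection[OF _ subspace_H2, of x] closed_H2
    by (metis complete_eq_closed)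
  have "cinner (x - p) s = 0" if "s \<in> H2" for s
  proof (rule complex_eqI)
    show "Re (cinner (x - p) s) = Re 0"
      by (simp add: Re_cinner p(2)[OF that])
    \<comment> \<open>\<open>H2\<close> is closed under multiplication by \<open>\<i>\<close>, so
      real orthogonality also holds for \<open>\<i> *\<^sub>C s\<close>; this is the imaginary
      part.\<close>
    have "Re (cinner (x - p) (\<i> *\<^sub>C s)) = 0"
      using p(2)[OF H2_lincomb[OF that that, of \<i> 0]]
      by (simp add: Re_cinner scaleC.zero_left)
    then show "Im (cinner (x - p) s) = Im 0"
      by (simp add: cinner_scaleC_right)
  qed
  with p(1) that show ?thesis by blast
qed


section \<open>Uniqueness of Fourier coefficients\<close>

text \<open>Integrability is included so that the class is stable under the operations below. All
  integers \<open>n\<close> occur, so multiplication by \<open>z powi m\<close> merely permutes the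
  conditions.\<close>

definition vanishing :: "(complex \<Rightarrow> complex) \<Rightarrow> bool" where
  "vanishing \<phi> \<longleftrightarrow> integrable circle_measure \<phi> \<and>
    (\<forall>n. (LINT z|circle_measure. z powi n * \<phi> z) = 0)"

lemma integrable_circle_times:
  fixes g :: "complex \<Rightarrow> complex"
  assumes "integrable circle_measure \<phi>" "continuous_on (sphere 0 1) g"
  shows "integrable circle_measure (\<lambda>z. g z * \<phi> z)"
proof -
  have "compact (g ` sphere 0 1)"
    by (intro compact_continuous_image assms compact_sphere)
  then obtain B where B: "\<And>z. z \<in> sphere 0 1 \<Longrightarrow> cmod (g z) \<le> B"
    by (meson bounded_iff compact_imp_bounded imageI)
  show ?thesis
  proof (rule Bochner_Integration.integrable_bound)
    show "integrable circle_measure (\<lambda>z. B * cmod (\<phi> z))"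
      using assms(1) by simp
    show "(\<lambda>z. g z * \<phi> z) \<in> borel_measurable circle_measure"
      by (intro borel_measurable_times borel_measurable_circle_continuous[OF assms(2)]
          borel_measurable_integrable[OF assms(1)])
    have "norm (g z * \<phi> z) \<le> norm (B * cmod (\<phi> z))" if "cmod z = 1" for z
    proof -
      have "cmod (g z) * cmod (\<phi> z) \<le> B * cmod (\<phi> z)"
        using B[of z] that by (intro mult_right_mono) auto
      then show ?thesis
        by (simp add: norm_mult abs_mult) (meson abs_ge_self mult_right_mono norm_ge_zero order_trans)
    qed
    then show "AE z in circle_measure. norm (g z * \<phi> z) \<le> norm (B * cmod (\<phi> z))"
      using AE_circle_norm by (rule eventually_mono[rotated])
  qed
qed

lemma integral_circle_cong:
  assumes "\<And>z. cmod z = 1 \<Longrightarrow> f z = g z"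
  shows "integral\<^sup>L circle_measure f = integral\<^sup>L circle_measure g"
  by (rule Bochner_Integration.integral_cong) (use assms in auto)

lemma integrable_circle_cong:
  assumes "\<And>z. cmod z = 1 \<Longrightarrow> f z = g z"
  shows "integrable circle_measure f \<longleftrightarrow> integrable circle_measure g"
  by (rule Bochner_Integration.integrable_cong) (use assms in auto)

lemma vanishing_cong:
  assumes "\<And>z. cmod z = 1 \<Longrightarrow> \<phi> z = \<psi> z"
  shows "vanishing \<phi> \<longleftrightarrow> vanishing \<psi>"
proof -
  have "(LINT z|circle_measure. z powi n * \<phi> z) = (LINT z|circle_measure. z powi n * \<psi> z)" for n
    by (rule integral_circle_cong) (simp add: assms)
  with integrable_circle_cong[of \<phi> \<psi>] assms show ?thesis
    unfolding vanishing_def by auto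
qed

lemma integrable_powi_times:
  "integrable circle_measure \<phi> \<Longrightarrow> integrable circle_measure (\<lambda>z. z powi n * \<phi> z)"
  by (rule integrable_circle_times[OF _ continuous_on_circle_powi])

lemma vanishing_lincomb:
  assumes "vanishing \<phi>" "vanishing \<psi>"
  shows "vanishing (\<lambda>z. a * \<phi> z + b * \<psi> z)"
proof -
  have i: "integrable circle_measure \<phi>" "integrable circle_measure \<psi>"
    using assms by (auto simp: vanishing_def)
  have "(LINT z|circle_measure. z powi n * (a * \<phi> z + b * \<psi> z)) = 0" for n
  proof -
    have "(LINT z|circle_measure. z powi n * (a * \<phi> z + b * \<psi> z)) =
        (LINT z|circle_measure. a * (z powi n * \<phi> z) + b * (z powi n * \<psi> z))"
      by (simp add: algebra_simps)
    also have "\<dots> = 0"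
      using assms i by (subst Bochner_Integration.integral_add)
        (auto simp: vanishing_def integrable_powi_times)
    finally show ?thesis .
  qed
  with i show ?thesis
    by (auto simp: vanishing_def)
qed

lemma vanishing_powi:
  assumes "vanishing \<phi>"
  shows "vanishing (\<lambda>z. z powi m * \<phi> z)"
proof -
  have "(LINT z|circle_measure. z powi n * (z powi m * \<phi> z)) = (LINT z|circle_measure. z powi (n + m) * \<phi> z)" for n
  proof (rule integral_circle_cong)
    fix z :: complex assume "cmod z = 1"
    then have "z \<noteq> 0" by auto
    then show "z powi n * (z powi m * \<phi> z) = z powi (n + m) * \<phi> z"
      by (simp add: power_int_add)
  qed
  with assms show ?thesis
    by (simp add: vanishing_def integrable_powi_times)
qed

text \<open>On the circle \<open>cnj z\<close> is \<open>z powi (- 1)\<close>, so a real linear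
  function is a combination of \<open>z\<close> and \<open>z powi (- 1)\<close>, and multiplication
  by it only shifts and combines Fourier coefficients.\<close>

lemma vanishing_polynomial:
  assumes "real_polynomial_function p" "vanishing \<phi>"
  shows "vanishing (\<lambda>z. of_real (p z) * \<phi> z)"
  using assms
proof (induction arbitrary: \<phi> rule: real_polynomial_function.induct)
  case (linear p)
  interpret p: bounded_linear p by fact
  \<comment> \<open>From \<open>p z = Re z * p 1 + Im z * p \<i>\<close>, with \<open>Re z\<close>
    and \<open>Im z\<close> expressed through \<open>z\<close> and \<open>cnj z\<close>.\<close>
  define a where "a = (of_real (p 1) - \<i> * of_real (p \<i>)) / 2"
  define b where "b = (of_real (p 1) + \<i> * of_real (p \<i>)) / 2"
  have "vanishing (\<lambda>z. a * (z powi 1 * \<phi> z) + b * (z powi (- 1) * \<phi> z))"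
    by (intro vanishing_lincomb vanishing_powi linear)
  moreover have "of_real (p z) * \<phi> z = a * (z powi 1 * \<phi> z) + b * (z powi (- 1) * \<phi> z)"
    if "cmod z = 1" for z
  proof -
    have "p z = p (Re z *\<^sub>R 1 + Im z *\<^sub>R \<i>)"
      by (rule arg_cong[where f = p]) (simp add: complex_eq_iff)
    also have "\<dots> = Re z * p 1 + Im z * p \<i>"
      by (simp add: p.add p.scaleR)
    finally have "complex_of_real (p z) = a * z + b * cnj z"
      by (simp add: a_def b_def complex_eq_iff field_simps)
    also have "cnj z = z powi (- 1)"
      using cnj_powi_circle[OF that, of 1] by simp
    finally show ?thesis
      by (simp add: algebra_simps)
  qed
  ultimately show ?case
    using vanishing_cong by (metis (no_types, lifting))
next
  case (const c)
  show ?case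
    using vanishing_lincomb[OF const const, of "of_real c" 0] by simp
next
  case (add p q)
  show ?case
    using vanishing_lincomb[OF add.IH(1)[OF add.prems] add.IH(2)[OF add.prems], of 1 1]
    by (simp add: algebra_simps)
next
  case (mult p q)
  \<comment> \<open>The factor \<open>q\<close> is absorbed into \<open>\<phi>\<close> first, which
    is why the induction keeps \<open>\<phi>\<close> arbitrary.\<close>
  show ?case
    using mult.IH(1)[OF mult.IH(2)[OF mult.prems]] by (simp add: mult.assoc)
qed

text \<open>By Stone-Weierstrass \<open>g\<close> is uniformly close to a real polynomial, for which
  the integral is zero; the error is at most \<open>e\<close> times the L1 norm of
  \<open>\<phi>\<close>.\<close>

lemma vanishing_continuous:
  fixes g :: "complex \<Rightarrow> real"
  assumes v: "vanishing \<phi>" and g: "continuous_on (sphere 0 1) g"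
  shows "(LINT z|circle_measure. of_real (g z) * \<phi> z) = 0"
proof -
  have i: "integrable circle_measure \<phi>"
    using v by (simp add: vanishing_def)
  define I where "I = (LINT z|circle_measure. cmod (\<phi> z))"
  have "cmod (LINT z|circle_measure. of_real (g z) * \<phi> z) \<le> e * I" if e: "e > 0" for e
  proof -
    obtain p where p: "real_polynomial_function p" "\<And>z. z \<in> sphere 0 1 \<Longrightarrow> \<bar>g z - p z\<bar> < e"
      using Stone_Weierstrass_real_polynomial_function[OF compact_sphere g e] by blast
    have pc: "continuous_on (sphere 0 1) p"
      by (rule continuous_at_imp_continuous_on) (use continuous_real_polymonial_function[OF p(1)] in blast)
    have gi: "integrable circle_measure (\<lambda>z. of_real (g z) * \<phi> z)"
      and pi: "integrable circle_measure (\<lambda>z. of_real (p z) * \<phi> z)"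
      by (rule integrable_circle_times[OF i continuous_on_of_real[OF g]]
          integrable_circle_times[OF i continuous_on_of_real[OF pc]])+
    have "(LINT z|circle_measure. of_real (p z) * \<phi> z) = (LINT z|circle_measure. z powi 0 * (of_real (p z) * \<phi> z))"
      by simp
    also have "\<dots> = 0"
      using vanishing_polynomial[OF p(1) v] unfolding vanishing_def by blast
    finally have "(LINT z|circle_measure. of_real (g z) * \<phi> z)
        = (LINT z|circle_measure. of_real (g z) * \<phi> z) - (LINT z|circle_measure. of_real (p z) * \<phi> z)"
      by simp
    also have "\<dots> = (LINT z|circle_measure. of_real (g z - p z) * \<phi> z)"
      unfolding Bochner_Integration.integral_diff[OF gi pi, symmetric]
      by (simp add: left_diff_distrib)
    also have "cmod \<dots> \<le> (LINT z|circle_measure. e * cmod (\<phi> z))"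
    proof (rule Bochner_Integration.integral_norm_bound_integral)
      show "integrable circle_measure (\<lambda>z. complex_of_real (g z - p z) * \<phi> z)"
        using Bochner_Integration.integrable_diff[OF gi pi] by (simp add: left_diff_distrib)
      show "integrable circle_measure (\<lambda>z. e * cmod (\<phi> z))"
        using i by simp
      fix z assume "z \<in> space circle_measure"
      then have "\<bar>g z - p z\<bar> * cmod (\<phi> z) \<le> e * cmod (\<phi> z)"
        using p(2)[of z] by (intro mult_right_mono) auto
      then show "norm (complex_of_real (g z - p z) * \<phi> z) \<le> e * cmod (\<phi> z)"
        by (simp add: norm_mult del: of_real_diff)
    qed
    also have "\<dots> = e * I"
      by (simp add: I_def)
    finally show ?thesis .
  qed
  note le = this
  have I0: "0 \<le> I"
    unfolding I_def by (rule integral_nonneg_AE) simp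
  have "cmod (LINT z|circle_measure. of_real (g z) * \<phi> z) \<le> 0 + e" if "e > 0" for e
  proof -
    \<comment> \<open>Dividing by \<open>I + 1\<close> rather than \<open>I\<close> covers the case
      \<open>I = 0\<close>.\<close>
    have "e / (I + 1) * I \<le> e"
      using I0 that by (simp add: field_simps)
    moreover have "e / (I + 1) > 0"
      using I0 that by simp
    ultimately show ?thesis
      using le[of "e / (I + 1)"] by simp
  qed
  then have "cmod (LINT z|circle_measure. of_real (g z) * \<phi> z) \<le> 0"
    by (rule field_le_epsilon)
  then show ?thesis by simp
qed

lemma sets_circle_borel: "A \<in> sets borel \<Longrightarrow> A \<inter> sphere 0 1 \<in> sets circle_measure"
  unfolding circle_measure_def
  by (rule sets_completionI_sets) (auto simp: sets_restrict_space)

text \<open>The indicator of a closed set is the pointwise limit of the continuous functions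
  \<open>max 0 (1 - real n * infdist z C)\<close>, which lie between 0 and 1, so dominated
  convergence applies.\<close>

lemma vanishing_closed:
  assumes v: "vanishing \<phi>" and C: "closed C"
  shows "(LINT z|circle_measure. indicator (C \<inter> sphere 0 1) z *\<^sub>R \<phi> z) = 0"
\<comment> \<open>\<open>infdist\<close> to the empty set is 0 by convention, so the approximation
  would fail for it.\<close>
proof (cases "C = {}")
  case False
  have i: "integrable circle_measure \<phi>"
    using v by (simp add: vanishing_def)
  then have m: "\<phi> \<in> borel_measurable circle_measure" by simp
  define g where "g n z = max 0 (1 - real n * infdist z C)" for n z
  have gc: "continuous_on (sphere 0 1) (g n)" for n
    unfolding g_def by (intro continuous_intros)
  have "(\<lambda>n. LINT z|circle_measure. of_real (g n z) * \<phi> z)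
      \<longlonglongrightarrow> (LINT z|circle_measure. indicator (C \<inter> sphere 0 1) z *\<^sub>R \<phi> z)"
  proof (rule integral_dominated_convergence)
    show "(\<lambda>z. indicator (C \<inter> sphere 0 1) z *\<^sub>R \<phi> z) \<in> borel_measurable circle_measure"
      by (rule borel_measurable_scaleR[OF borel_measurable_indicator m])
        (rule sets_circle_borel[OF borel_closed[OF C]])
    show "(\<lambda>z. of_real (g n z) * \<phi> z) \<in> borel_measurable circle_measure" for n
      by (rule borel_measurable_integrable[OF integrable_circle_times[OF i]])
        (intro continuous_intros gc)
    show "integrable circle_measure (\<lambda>z. cmod (\<phi> z))"
      using i by simp
    have "\<bar>g n z\<bar> \<le> 1" for n z
      by (simp add: g_def infdist_nonneg)
    then show "AE z in circle_measure. norm (of_real (g n z) * \<phi> z) \<le> cmod (\<phi> z)" for n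
      by (simp add: norm_mult mult_left_le_one_le)
    have "(\<lambda>n. of_real (g n z) * \<phi> z) \<longlonglongrightarrow> indicator (C \<inter> sphere 0 1) z *\<^sub>R \<phi> z"
      if z: "cmod z = 1" for z
    proof (cases "z \<in> C")
      case True
      then show ?thesis using z by (simp add: g_def)
    next
      case F: False
      then have pos: "infdist z C > 0"
        using C False by (intro infdist_pos_not_in_closed)
      obtain N where N: "1 / infdist z C < real N"
        using reals_Archimedean2 by blast
      have "g n z = 0" if "n \<ge> N" for n
      proof -
        have "1 / infdist z C < real n" using N that by (meson less_le_trans of_nat_mono)
        then have "1 < real n * infdist z C"
          using pos by (simp add: field_simps)
        then show ?thesis by (simp add: g_def)
      qed
      then have "\<forall>\<^sub>F n in sequentially. of_real (g n z) * \<phi> z = 0"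
        unfolding eventually_sequentially by (intro exI[of _ N]) simp
      then show ?thesis
        using F by (simp add: tendsto_eventually)
    qed
    then show "AE z in circle_measure. (\<lambda>n. of_real (g n z) * \<phi> z) \<longlonglongrightarrow> indicator (C \<inter> sphere 0 1) z *\<^sub>R \<phi> z"
      using AE_circle_norm by (rule eventually_mono[rotated])
  qed
  then show ?thesis
    by (simp add: vanishing_continuous[OF v gc] LIMSEQ_const_iff)
qed simp

text \<open>Dynkin's theorem: closed sets are stable under intersection and generate the Borel sets,
  and the sets with zero integral are stable under complements and countable disjoint
  unions.\<close>

lemma vanishing_borel:
  assumes v: "vanishing \<phi>" and A: "A \<in> sets borel"
  shows "(LINT z|circle_measure. indicator (A \<inter> sphere 0 1) z *\<^sub>R \<phi> z) = 0"
proof -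
  have i: "integrable circle_measure \<phi>"
    using v by (simp add: vanishing_def)
  have ii: "integrable circle_measure (\<lambda>z. indicator (A \<inter> sphere 0 1) z *\<^sub>R \<phi> z)" if "A \<in> sets borel" for A
    by (rule integrable_mult_indicator[OF sets_circle_borel[OF that] i])
  have Int_stable_closed: "Int_stable (Collect closed :: complex set set)"
    by (auto simp: Int_stable_def)
  have closed_Pow: "Collect closed \<subseteq> Pow (UNIV :: complex set)"
    by simp
  have "A \<in> sigma_sets UNIV (Collect closed)"
    using A by (simp add: borel_eq_closed)
  with Int_stable_closed closed_Pow show ?thesis
  proof (induction rule: sigma_sets_induct_disjoint)
    case (basic A)
    then show ?case by (simp add: vanishing_closed[OF v])
  next
    case (compl A)
    then have AB: "A \<in> sets borel"
      by (simp add: borel_eq_closed)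
    have "(LINT z|circle_measure. indicator ((UNIV - A) \<inter> sphere 0 1) z *\<^sub>R \<phi> z)
        = (LINT z|circle_measure. \<phi> z - indicator (A \<inter> sphere 0 1) z *\<^sub>R \<phi> z)"
      by (rule integral_circle_cong) (auto simp: indicator_def)
    also have "\<dots> = (LINT z|circle_measure. \<phi> z)"
      using compl.IH by (simp add: Bochner_Integration.integral_diff[OF i ii[OF AB]])
    \<comment> \<open>The condition for \<open>n = 0\<close> is the integral of
      \<open>\<phi>\<close> itself.\<close>
    also have "\<dots> = 0"
      using v by (auto simp: vanishing_def dest: spec[of _ 0])
    finally show ?case .
  next
    case (union F)
    have FB: "F k \<in> sets borel" for k
      using union.hyps(2) by (auto simp: borel_eq_closed)
    have "(LINT z:(\<Union>k. F k \<inter> sphere 0 1)|circle_measure. \<phi> z) = (\<Sum>k. (LINT z:(F k \<inter> sphere 0 1)|circle_measure. \<phi> z))"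
    proof (rule lebesgue_integral_countable_add)
      show "F k \<inter> sphere 0 1 \<in> sets circle_measure" for k
        by (rule sets_circle_borel[OF FB])
      show "(F k \<inter> sphere 0 1) \<inter> (F j \<inter> sphere 0 1) = {}" if "k \<noteq> j" for j k
        using union.hyps(1) that unfolding disjoint_family_on_def by blast
      have "(\<Union>k. F k) \<in> sets borel" using FB by blast
      then show "set_integrable circle_measure (\<Union>k. F k \<inter> sphere 0 1) \<phi>"
        using ii[of "\<Union>k. F k"] by (simp add: set_integrable_def)
    qed
    then show ?case
      using union.IH by (simp add: set_lebesgue_integral_def)
  qed simp
qed

text \<open>A set of the completed measure is the trace of a Borel set up to a null set.\<close>

lemma vanishing_sets:
  assumes v: "vanishing \<phi>" and A: "A \<in> sets circle_measure"
  shows "(LINT z|circle_measure. indicator A z *\<^sub>R \<phi> z) = 0"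
proof -
  have i: "integrable circle_measure \<phi>"
    using v by (simp add: vanishing_def)
  obtain S N N' where S: "A = S \<union> N" "N \<subseteq> N'"
    "N' \<in> null_sets (distr (uniform_measure lborel {0..2*pi}) (restrict_space borel (sphere 0 1)) cis)"
    "S \<in> sets (distr (uniform_measure lborel {0..2*pi}) (restrict_space borel (sphere 0 1)) cis)"
    using sets_completionE[OF A[unfolded circle_measure_def]] .
  from S(4) obtain B where B: "B \<in> sets borel" "S = B \<inter> sphere 0 1"
    by (auto simp: sets_restrict_space)
  have SA: "S \<in> sets circle_measure"
    unfolding B(2) by (rule sets_circle_borel[OF B(1)])
  have "AE z in circle_measure. z \<notin> N'"
    unfolding circle_measure_def by (rule AE_completion[OF AE_not_in[OF S(3)]])
  then have "AE z in circle_measure. indicator A z *\<^sub>R \<phi> z = indicator S z *\<^sub>R \<phi> z"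
    by eventually_elim (use S(1,2) in \<open>auto simp: indicator_def\<close>)
  then have "(LINT z|circle_measure. indicator A z *\<^sub>R \<phi> z) = (LINT z|circle_measure. indicator S z *\<^sub>R \<phi> z)"
    by (intro integral_cong_AE borel_measurable_integrable integrable_mult_indicator A SA i)
  then show ?thesis
    unfolding B(2) vanishing_borel[OF v B(1)] .
qed

text \<open>Tested on the set where \<open>u\<close> is positive: there a nonnegative function has
  integral zero.\<close>

lemma AE_le_0_if_set_integrals_0:
  fixes u :: "'a \<Rightarrow> real"
  assumes u: "integrable M u" and 0: "\<And>A. A \<in> sets M \<Longrightarrow> (LINT z|M. indicator A z *\<^sub>R u z) = 0"
  shows "AE z in M. u z \<le> 0"
proof -
  have um [measurable]: "u \<in> borel_measurable M" using u by simp
  define A where "A = {z \<in> space M. u z > 0}"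
  have A: "A \<in> sets M" unfolding A_def by measurable
  have "AE z in M. indicator A z *\<^sub>R u z = 0"
  proof (subst integral_nonneg_eq_0_iff_AE[symmetric])
    show "integrable M (\<lambda>z. indicator A z *\<^sub>R u z)"
      by (rule integrable_mult_indicator[OF A u])
    show "AE z in M. 0 \<le> indicator A z *\<^sub>R u z"
      by (rule AE_I2) (auto simp: A_def indicator_def)
  qed (rule 0[OF A])
  then show ?thesis
    using AE_space by eventually_elim (auto simp: A_def indicator_def split: if_splits)
qed

lemma AE_eq_0_if_set_integrals_0:
  fixes u :: "'a \<Rightarrow> real"
  assumes "integrable M u" and "\<And>A. A \<in> sets M \<Longrightarrow> (LINT z|M. indicator A z *\<^sub>R u z) = 0"
  shows "AE z in M. u z = 0"
proof -
  have "AE z in M. u z \<le> 0"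
    by (rule AE_le_0_if_set_integrals_0[OF assms])
  moreover have "AE z in M. - u z \<le> 0"
    by (rule AE_le_0_if_set_integrals_0) (simp_all add: assms(1) assms(2)[unfolded real_scaleR_def])
  ultimately show ?thesis
    by eventually_elim simp
qed

lemma vanishing_AE:
  assumes v: "vanishing \<phi>"
  shows "AE z in circle_measure. \<phi> z = 0"
proof -
  have i: "integrable circle_measure \<phi>"
    using v by (simp add: vanishing_def)
  have ii: "integrable circle_measure (\<lambda>z. indicator A z *\<^sub>R \<phi> z)" if "A \<in> sets circle_measure" for A
    by (rule integrable_mult_indicator[OF that i])
  have "AE z in circle_measure. Re (\<phi> z) = 0"
    by (rule AE_eq_0_if_set_integrals_0)
      (use integral_Re[OF ii] vanishing_sets[OF v] i in auto)
  moreover have "AE z in circle_measure. Im (\<phi> z) = 0"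
    by (rule AE_eq_0_if_set_integrals_0)
      (use integral_Im[OF ii] vanishing_sets[OF v] i in auto)
  ultimately show ?thesis
    by eventually_elim (simp add: complex_eq_iff)
qed

text \<open>Each pairing with a fixed vector is a scalar function with zero coefficients. The
  finitely many vectors of a real basis suffice, so the exceptional null sets can be united.\<close>

lemma L2_eq_0_if_fourier_coeffs_0:
  fixes f :: "'h :: {complex_inner, euclidean_space} L2"
  assumes "\<And>n. fourier_coeff f n = 0"
  shows "f = 0"
proof (rule L2_eqI)
  have "vanishing (\<lambda>z. cinner (rep_L2 f z) y)" for y
    unfolding vanishing_def integral_powi_cinner assms
    by (intro conjI integrable_bounded_linear[OF cinner.bounded_linear_left]
        square_integrable_imp_integrable square_integrable_rep) simp
  then have "AE z in circle_measure. \<forall>b\<in>(Basis :: 'h set). cinner (rep_L2 f z) b = 0"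
    by (intro AE_finite_allI vanishing_AE) auto
  then show "AE z in circle_measure. rep_L2 f z = rep_L2 0 z"
    using rep_zero[where 'a = 'h]
  proof eventually_elim
    case (elim z)
    then have "\<forall>b\<in>Basis. inner (rep_L2 f z) b = 0"
      by (metis Re_cinner zero_complex.sel(1))
    then have "rep_L2 f z = 0"
      by (simp add: euclidean_all_zero_iff)
    with elim show ?case by simp
  qed
qed

section \<open>Orthogonality of monomials and density of polynomials\<close>

lemma integral_powi_circle:
  assumes "k \<noteq> 0"
  shows "(LINT z|circle_measure. z powi k) = 0"
proof -
  let ?M = "distr (uniform_measure lborel {0..2*pi}) (restrict_space borel (sphere 0 1)) cis"
  have m: "(\<lambda>z. z powi k) \<in> borel_measurable (restrict_space borel (sphere (0 :: complex) 1))"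
    by (rule borel_measurable_continuous_on_restrict[OF continuous_on_circle_powi])
  have "(LINT z|circle_measure. z powi k) = (LINT z|?M. z powi k)"
    unfolding circle_measure_def by (rule integral_completion) (use m in simp)
  also have "\<dots> = (LINT t|uniform_measure lborel {0..2*pi}. cis t powi k)"
    by (rule integral_distr[OF measurable_cis m])
  also have "uniform_measure lborel {0..2*pi} = density lborel (\<lambda>t. ennreal (indicator {0..2*pi} t / (2*pi)))"
    unfolding uniform_measure_def
    by (rule arg_cong[where f = "density lborel"])
      (auto simp: fun_eq_iff indicator_def divide_ennreal[symmetric] ennreal_numeral[symmetric] simp del: ennreal_numeral)
  also have "(LINT t|density lborel (\<lambda>t. ennreal (indicator {0..2*pi} t / (2*pi))). cis t powi k)
      = (LINT t|lborel. (indicator {0..2*pi} t / (2*pi)) *\<^sub>R (cis t powi k))"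
  proof (rule integral_density)
    have "continuous_on UNIV (\<lambda>t. cis t powi k)"
      by (intro continuous_on_power_int continuous_on_cis continuous_on_id) simp
    then show "(\<lambda>t. cis t powi k) \<in> borel_measurable lborel"
      by (simp add: borel_measurable_continuous_onI)
    show "(\<lambda>t. indicator {0..2*pi} t / (2*pi)) \<in> borel_measurable lborel"
      by simp
  qed simp
  also have "\<dots> = (LINT t|lborel. indicator {0..2*pi} t *\<^sub>R (cis (of_int k * t) / (2*pi)))"
    by (rule Bochner_Integration.integral_cong) (auto simp: indicator_def Complex.cis_power_int scaleR_conv_of_real)
  \<comment> \<open>The primitive is divided by \<open>\<i> * of_int k\<close>, which is nonzero by
    assumption; as \<open>k\<close> is an integer it takes equal values at both ends.\<close>
  also have "\<dots> = cis (of_int k * (2*pi)) / (\<i> * of_int k * (2*pi)) - cis (of_int k * 0) / (\<i> * of_int k * (2*pi))"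
  proof (rule integral_FTC_Icc)
    show "continuous_on {0..2*pi} (\<lambda>t. cis (of_int k * t) / (2*pi))"
      by (intro continuous_intros) auto
    fix t
    have "((\<lambda>t. exp (\<i> * of_int k * t) / (\<i> * of_int k * (2*pi))) has_field_derivative
        exp (\<i> * of_int k * complex_of_real t) / (2*pi)) (at (of_real t) within S)" for S
    proof -
      have "((\<lambda>t. exp (\<i> * of_int k * t) / (\<i> * of_int k * (2*pi))) has_field_derivative
          exp (\<i> * of_int k * of_real t) * (\<i> * of_int k) / (\<i> * of_int k * (2*pi))) (at (of_real t) within S)"
        by (intro DERIV_cdivide DERIV_chain2[OF DERIV_exp DERIV_cmult_Id])
      then show ?thesis
        using assms by simp
    qed
    from has_vector_derivative_real_field[OF this]
    show "((\<lambda>t. cis (of_int k * t) / (\<i> * of_int k * (2*pi))) has_vector_derivative cis (of_int k * t) / (2*pi))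
        (at t within {0..2*pi})"
      by (simp add: cis_conv_exp mult.assoc)
  qed simp
  also have "cis (of_int k * (2*pi)) = 1"
    by (metis cis_multiple_2pi mult.commute Ints_of_int)
  finally show ?thesis by simp
qed

lemma monomial_in_H2:
  fixes y :: "'h :: {complex_inner, euclidean_space}"
  assumes "n \<ge> 0"
  shows "monomial n y \<in> H2"
  unfolding H2_iff
proof (intro allI impI)
  fix m :: int and x :: 'h
  assume "m < 0"
  then have nm: "n - m \<noteq> 0" using assms by simp
  have "cinner (monomial n y) (monomial m x) = (LINT z|circle_measure. z powi (n - m) * cinner y x)"
    unfolding cinner_rep
  proof (rule integral_cong_AE)
    show "AE z in circle_measure. cinner (rep_L2 (monomial n y) z) (rep_L2 (monomial m x) z)
        = z powi (n - m) * cinner y x"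
      using rep_monomial[of n y] rep_monomial[of m x] AE_circle_norm
    proof eventually_elim
      case (elim z)
      then have "z \<noteq> 0" by auto
      then have "z powi (n - m) = z powi n * z powi (- m)"
        by (simp add: power_int_add[symmetric])
      with elim show ?case
        by (simp add: cinner_scaleC_right cinner_scaleC_left cnj_powi_circle del: complex_cnj_power_int)
    qed
    show "(\<lambda>z. z powi (n - m) * cinner y x) \<in> borel_measurable circle_measure"
      by (intro borel_measurable_times borel_measurable_circle_continuous continuous_on_circle_powi) simp
  qed (rule borel_measurable_cinner[OF rep_measurable rep_measurable])
  then show "cinner (monomial n y) (monomial m x) = 0"
    by (simp add: integral_powi_circle[OF nm])
qed

text \<open>Polynomials are dense in \<open>H\<^sup>2\<close>.\<close>

lemma orthogonal_H2_if_orthogonal_monomials: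
  fixes g :: "'h :: {complex_inner, euclidean_space} L2"
  assumes g: "\<And>n. n \<ge> 0 \<Longrightarrow> fourier_coeff g n = 0" and h: "h \<in> H2"
  shows "cinner g h = 0"
proof -
  \<comment> \<open>The projection \<open>p\<close> of \<open>g\<close> has zero coefficients: for
    \<open>n < 0\<close> because \<open>p \<in> H2\<close>, for \<open>n \<ge> 0\<close> because
    \<open>p\<close> and \<open>g\<close> agree against these monomials. Hence \<open>p = 0\<close>,
    and \<open>g\<close> itself is orthogonal to \<open>H2\<close>.\<close>
  obtain p where p: "p \<in> H2" "\<And>s. s \<in> H2 \<Longrightarrow> cinner (g - p) s = 0"
    using H2_projection by blast
  have "fourier_coeff p n = 0" for n
  proof (cases "n < 0")
    case True
    then show ?thesis using p(1) by (simp add: H2_def)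
  next
    case False
    have "cinner p (monomial n y) = 0" for y
    proof -
      have "cinner (g - p) (monomial n y) = 0"
        using False by (intro p(2) monomial_in_H2) simp
      moreover have "cinner g (monomial n y) = 0"
        using g[of n] False by (simp add: cinner_monomial)
      ultimately show ?thesis
        by (simp add: cinner.diff_left)
    qed
    then show ?thesis
      by (simp add: fourier_coeff_eq_0_iff)
  qed
  then have "p = 0"
    by (rule L2_eq_0_if_fourier_coeffs_0)
  with p(2)[OF h] show ?thesis by simp
qed


section \<open>Multiplication by inner functions\<close>

text \<open>Limits of measurable functions and dominated convergence are taken along sequences, so
  the radial limit is sampled at these radii. The summand 2 keeps the first radius positive.\<close>

definition radii :: "nat \<Rightarrow> real" where
  "radii n = 1 - 1 / (real n + 2)"

lemma radii: "0 < radii n" "radii n < 1"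
  by (auto simp: radii_def field_simps)

lemma radii_tendsto: "filterlim radii (at_left 1) sequentially"
  unfolding filterlim_at
proof (intro conjI)
  have "(\<lambda>n. 1 - inverse (real (Suc (Suc n)))) \<longlonglongrightarrow> 1 - 0"
    by (intro tendsto_diff tendsto_const LIMSEQ_Suc[OF LIMSEQ_inverse_real_of_nat])
  then show "radii \<longlonglongrightarrow> 1"
    by (simp add: radii_def[abs_def] inverse_eq_divide add.commute)
  show "\<forall>\<^sub>F n in sequentially. radii n \<in> {..<1} \<and> radii n \<noteq> 1"
    using radii(2) by (intro always_eventually) (metis lessThan_iff less_irrefl)
qed

section \<open>Bounds and boundary values of bounded analytic functions\<close>

lemma
  assumes "F \<in> Hinf"
  shows Hinf_linear: "z \<in> ball 0 1 \<Longrightarrow> complex_linear (F z)"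
    and Hinf_derivative: "z \<in> ball 0 1 \<Longrightarrow> \<exists>D. (F has_derivative (\<lambda>h. h *\<^sub>C D)) (at z)"
    and Hinf_bounded: "bounded (F ` ball 0 1)"
    and Hinf_limit: "AE z in circle_measure. ((\<lambda>r. F (r *\<^sub>R z)) \<longlongrightarrow> F z) (at_left (1::real))"
  using assms unfolding Hinf_def by blast+

lemma Hinf_radii:
  assumes "F \<in> Hinf"
  shows "AE z in circle_measure. (\<lambda>n. F (radii n *\<^sub>R z)) \<longlonglongrightarrow> F z"
  using Hinf_limit[OF assms]
  by eventually_elim (rule filterlim_compose[OF _ radii_tendsto])

lemma Hinf_bound:
  assumes "F \<in> Hinf"
  obtains B where "B \<ge> 0" "\<And>w x. cmod w < 1 \<Longrightarrow> norm (F w x) \<le> B * norm x"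
proof -
  obtain B where B: "\<And>w. w \<in> ball 0 1 \<Longrightarrow> norm (F w) \<le> B"
    using Hinf_bounded[OF assms] by (meson bounded_iff imageI)
  have "0 \<le> B"
    using B[of 0] norm_ge_zero[of "F 0"] by (simp del: norm_ge_zero)
  moreover have "norm (F w x) \<le> B * norm x" if "cmod w < 1" for w x
    using norm_blinfun[of "F w" x] B[of w] that
    by (meson mem_ball_0 mult_right_mono norm_ge_zero order_trans)
  ultimately show ?thesis
    using that by blast
qed

lemma radii_scaleR_norm: "cmod z = 1 \<Longrightarrow> cmod (radii n *\<^sub>R z) < 1"
  using radii[of n] by simp

lemma Hinf_continuous:
  assumes "F \<in> Hinf"
  shows "continuous_on (ball 0 1) F"
proof (rule continuous_at_imp_continuous_on, rule ballI)
  fix z :: complex assume "z \<in> ball 0 1"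
  then show "isCont F z"
    using Hinf_derivative[OF assms] has_derivative_continuous by blast
qed

text \<open>Expanding \<open>f z\<close> in the basis leaves finitely many products of a scalar
  coordinate with a function \<open>A z b\<close>.\<close>

lemma borel_measurable_blinfun_apply:
  fixes A :: "'b \<Rightarrow> 'h \<Rightarrow>\<^sub>L 'h :: {complex_inner, euclidean_space}"
  assumes A: "\<And>b. (\<lambda>z. A z b) \<in> borel_measurable M" and f: "f \<in> borel_measurable M"
  shows "(\<lambda>z. A z (f z)) \<in> borel_measurable M"
proof -
  have "A z (f z) = (\<Sum>b\<in>Basis. inner (f z) b *\<^sub>R A z b)" for z
    by (subst (1) euclidean_representation[of "f z", symmetric])
      (simp only: blinfun.sum_right blinfun.scaleR_right)
  moreover have "(\<lambda>z. \<Sum>b\<in>Basis. inner (f z) b *\<^sub>R A z b) \<in> borel_measurable M"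
    by (intro borel_measurable_sum borel_measurable_scaleR borel_measurable_inner A f
        borel_measurable_const)
  ultimately show ?thesis by presburger
qed

lemma Hinf_dilation_measurable:
  assumes F: "F \<in> Hinf" and r: "0 < r" "r < 1" and f: "f \<in> borel_measurable circle_measure"
  shows "(\<lambda>z. F (r *\<^sub>R z) (f z)) \<in> borel_measurable circle_measure"
proof (rule borel_measurable_blinfun_apply[OF borel_measurable_circle_continuous f])
  fix b
  have "continuous_on (sphere 0 1) (\<lambda>z. F (r *\<^sub>R z))"
    by (rule continuous_on_compose2[OF Hinf_continuous[OF F]])
      (use r in \<open>auto intro!: continuous_intros\<close>)
  then show "continuous_on (sphere 0 1) (\<lambda>z. F (r *\<^sub>R z) b)"
    by (rule bounded_linear.continuous_on[OF blinfun.bounded_linear_left])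
qed

text \<open>The boundary function is almost everywhere the limit of its dilations, which are
  continuous on the circle.\<close>

lemma Hinf_boundary_measurable:
  assumes F: "F \<in> Hinf" and f: "f \<in> borel_measurable circle_measure"
  shows "(\<lambda>z. F z (f z)) \<in> borel_measurable circle_measure"
proof (rule borel_measurable_circle_AE)
  show "(\<lambda>z. lim (\<lambda>n. F (radii n *\<^sub>R z) (f z))) \<in> borel_measurable circle_measure"
    by (rule borel_measurable_lim_metric) (rule Hinf_dilation_measurable[OF F radii f])
  show "AE z in circle_measure. lim (\<lambda>n. F (radii n *\<^sub>R z) (f z)) = F z (f z)"
    using Hinf_radii[OF F]
    by eventually_elim
      (rule limI, rule bounded_linear.tendsto[OF blinfun.bounded_linear_left])
qed

text \<open>\<open>Hinf\<close> asserts complex linearity inside the disc; it passes to radial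
  limits.\<close>

lemma Hinf_boundary_linear:
  assumes F: "F \<in> Hinf"
  shows "AE z in circle_measure. complex_linear (F z)"
  using Hinf_radii[OF F] AE_circle_norm
proof eventually_elim
  case (elim z)
  have lim: "(\<lambda>n. F (radii n *\<^sub>R z) x) \<longlonglongrightarrow> F z x" for x
    by (rule bounded_linear.tendsto[OF blinfun.bounded_linear_left elim(1)])
  have "F z (a *\<^sub>C x) = a *\<^sub>C F z x" for a x
  proof (rule LIMSEQ_unique[OF lim])
    have "(\<lambda>n. a *\<^sub>C F (radii n *\<^sub>R z) x) \<longlonglongrightarrow> a *\<^sub>C F z x"
      by (rule bounded_linear.tendsto[OF scaleC.bounded_linear_right lim])
    moreover have "F (radii n *\<^sub>R z) (a *\<^sub>C x) = a *\<^sub>C F (radii n *\<^sub>R z) x" for n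
      using Hinf_linear[OF F, of "radii n *\<^sub>R z"] radii_scaleR_norm[OF elim(2)]
      by (simp add: complex_linear_def)
    ultimately show "(\<lambda>n. F (radii n *\<^sub>R z) (a *\<^sub>C x)) \<longlonglongrightarrow> a *\<^sub>C F z x" by simp
  qed
  then show ?case by (simp add: complex_linear_def)
qed

lemma pw_isometry_inner_function:
  assumes "inner_function F"
  shows "pw_isometry (\<lambda>z. blinfun_apply (F z))"
proof (rule pw_isometryI)
  have F: "F \<in> Hinf" and u: "AE z in circle_measure. unitary (F z)"
    using assms by (auto simp: inner_function_def)
  show "(\<lambda>z. F z (f z)) \<in> borel_measurable circle_measure" if "f \<in> borel_measurable circle_measure" for f
    by (rule Hinf_boundary_measurable[OF F that])
  show "AE z in circle_measure. \<forall>x. norm (F z x) = norm x"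
    using Hinf_boundary_linear[OF F] u by eventually_elim (simp add: unitary_norm)
qed

section \<open>Power series of the scalar entries\<close>

lemma Hinf_entry_holomorphic:
  assumes F: "F \<in> Hinf"
  shows "(\<lambda>w. cinner (F w v) y) holomorphic_on ball 0 1"
  unfolding holomorphic_on_open[OF open_ball]
proof
  fix w :: complex assume "w \<in> ball 0 1"
  then obtain D where D: "(F has_derivative (\<lambda>h. h *\<^sub>C D)) (at w)"
    using Hinf_derivative[OF F] by blast
  have "((\<lambda>w. cinner (F w v) y) has_derivative (\<lambda>h. cinner ((h *\<^sub>C D) v) y)) (at w)"
    by (intro bounded_linear.has_derivative[OF cinner.bounded_linear_left]
        bounded_linear.has_derivative[OF blinfun.bounded_linear_left] D)
  also have "(\<lambda>h. cinner ((h *\<^sub>C D) v) y) = (*) (cinner (D v) y)"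
    by (simp add: fun_eq_iff scaleC_blinfun.rep_eq cinner_scaleC_left mult.commute)
  finally show "\<exists>f'. ((\<lambda>w. cinner (F w v) y) has_field_derivative f') (at w)"
    unfolding has_field_derivative_def by blast
qed

text \<open>The vector \<open>v\<close> comes last so that \<open>taylor_coeff F y m\<close> is a
  functional, which can be moved across a Bochner integral.\<close>

definition taylor_coeff ::
  "(complex \<Rightarrow> 'h :: {complex_inner, euclidean_space} \<Rightarrow>\<^sub>L 'h) \<Rightarrow> 'h \<Rightarrow> nat \<Rightarrow> 'h \<Rightarrow> complex" where
  "taylor_coeff F y m v = (deriv ^^ m) (\<lambda>w. cinner (F w v) y) 0 / fact m"

lemma taylor_coeff_sums:
  assumes "F \<in> Hinf" "cmod w < 1"
  shows "(\<lambda>m. taylor_coeff F y m v * w ^ m) sums cinner (F w v) y"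
  using holomorphic_power_series[OF Hinf_entry_holomorphic[OF assms(1)], of w v y] assms(2)
  by (simp add: taylor_coeff_def)

lemma taylor_coeff_add:
  assumes F: "F \<in> Hinf"
  shows "taylor_coeff F y m (u + v) = taylor_coeff F y m u + taylor_coeff F y m v"
proof -
  have "(deriv ^^ m) (\<lambda>w. cinner (F w u) y + cinner (F w v) y) 0
      = (deriv ^^ m) (\<lambda>w. cinner (F w u) y) 0 + (deriv ^^ m) (\<lambda>w. cinner (F w v) y) 0"
    by (rule higher_deriv_add[OF Hinf_entry_holomorphic[OF F] Hinf_entry_holomorphic[OF F] open_ball]) simp
  then show ?thesis
    by (simp add: taylor_coeff_def blinfun.add_right cinner_add_left add_divide_distrib)
qed

lemma taylor_coeff_scaleC:
  assumes F: "F \<in> Hinf"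
  shows "taylor_coeff F y m (a *\<^sub>C v) = a * taylor_coeff F y m v"
proof -
  have "(deriv ^^ m) (\<lambda>w. cinner (F w (a *\<^sub>C v)) y) 0 = (deriv ^^ m) (\<lambda>w. a * cinner (F w v) y) 0"
  \<comment> \<open>Complex linearity of \<open>F w\<close> is available in the disc, and agreement
    near 0 determines the derivatives at 0.\<close>
  proof (rule higher_deriv_cong_ev[OF _ refl])
    have "\<forall>\<^sub>F w in nhds (0 :: complex). w \<in> ball 0 1"
      by (rule eventually_nhds_in_open) auto
    then show "\<forall>\<^sub>F w in nhds 0. cinner (F w (a *\<^sub>C v)) y = a * cinner (F w v) y"
    proof eventually_elim
      case (elim w)
      then show ?case
        using Hinf_linear[OF F, of w] by (simp add: complex_linear_def cinner_scaleC_left)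
    qed
  qed
  also have "\<dots> = a * (deriv ^^ m) (\<lambda>w. cinner (F w v) y) 0"
    by (rule higher_deriv_cmult[OF Hinf_entry_holomorphic[OF F] _ open_ball]) simp
  finally show ?thesis
    by (simp add: taylor_coeff_def)
qed

text \<open>Cauchy's estimate on the circle of radius \<open>R\<close>. For a dilation by
  \<open>r < R\<close> it makes the series decay with ratio \<open>r / R\<close>.\<close>

lemma taylor_coeff_bound:
  assumes F: "F \<in> Hinf" and B: "\<And>w x. cmod w < 1 \<Longrightarrow> norm (F w x) \<le> B * norm x"
    and R: "0 < R" "R < 1"
  shows "cmod (taylor_coeff F y m v) \<le> B * norm v * norm y / R ^ m"
proof -
  have "norm ((deriv ^^ m) (\<lambda>w. cinner (F w v) y) 0) \<le> fact m * (B * norm v * norm y) / R ^ m"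
  proof (rule Cauchy_inequality[OF _ _ R(1)])
    show "(\<lambda>w. cinner (F w v) y) holomorphic_on ball 0 R"
      by (rule holomorphic_on_subset[OF Hinf_entry_holomorphic[OF F]]) (use R in auto)
    show "continuous_on (cball 0 R) (\<lambda>w. cinner (F w v) y)"
      by (rule continuous_on_subset[OF holomorphic_on_imp_continuous_on[OF Hinf_entry_holomorphic[OF F]]])
        (use R in auto)
    fix w :: complex assume "norm (0 - w) = R"
    then have "cmod w < 1" using R by simp
    then show "norm (cinner (F w v) y) \<le> B * norm v * norm y"
      by (meson B cmod_cinner_le mult_right_mono norm_ge_zero order_trans)
  qed
  then show ?thesis
    by (simp add: taylor_coeff_def norm_divide field_simps)
qed

lemma taylor_coeff_bounded_linear:
  assumes F: "F \<in> Hinf"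
  shows "bounded_linear (taylor_coeff F y m)"
proof -
  obtain B where B: "B \<ge> 0" "\<And>w x. cmod w < 1 \<Longrightarrow> norm (F w x) \<le> B * norm x"
    using Hinf_bound[OF F] by blast
  show ?thesis
  proof (rule bounded_linear_intro)
    show "taylor_coeff F y m (r *\<^sub>R v) = r *\<^sub>R taylor_coeff F y m v" for r v
      by (metis taylor_coeff_scaleC[OF F] scaleC_of_real scaleR_conv_of_real)
    show "norm (taylor_coeff F y m v) \<le> norm v * (B * norm y / (1/2) ^ m)" for v
      using taylor_coeff_bound[OF F B(2), of "1/2" y m v] by (simp add: mult_ac)
  qed (rule taylor_coeff_add[OF F])
qed

text \<open>The integral is the \<open>n\<close>-th Fourier coefficient of the dilated product,
  paired with \<open>y\<close>. In the power series of \<open>F\<close> the term of degree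
  \<open>m\<close> sees only the coefficient of \<open>f\<close> with index
  \<open>n - m < 0\<close>, which is zero; absolute convergence allows termwise integration.\<close>

lemma integral_dilation_0:
  fixes F :: "complex \<Rightarrow> 'h :: {complex_inner, euclidean_space} \<Rightarrow>\<^sub>L 'h"
  assumes F: "F \<in> Hinf" and r: "0 < r" "r < 1" and f: "f \<in> H2" and n: "n < 0"
  shows "(LINT z|circle_measure. z powi (- n) * cinner (F (r *\<^sub>R z) (rep_L2 f z)) y) = 0"
proof -
  obtain B where B: "B \<ge> 0" "\<And>w x. cmod w < 1 \<Longrightarrow> norm (F w x) \<le> B * norm x"
    using Hinf_bound[OF F] by blast
  define c where "c = taylor_coeff F y"
  \<comment> \<open>Any radius strictly between \<open>r\<close> and 1 would do: Cauchy's estimate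
    there makes the terms decay like \<open>q ^ m\<close> with \<open>q < 1\<close>.\<close>
  define R where "R = (1 + r) / 2"
  have R: "0 < R" "R < 1" "r < R" using r by (auto simp: R_def)
  define q where "q = r / R"
  have q: "0 \<le> q" "q < 1" using R r by (auto simp: q_def)
  define K where "K = B * norm y"
  have K: "0 \<le> K" using B by (simp add: K_def)
  \<comment> \<open>The power of \<open>z\<close> sits inside the functional, so that integrating
    its argument gives a Fourier coefficient of \<open>f\<close>.\<close>
  define \<phi> where "\<phi> m z = of_real (r ^ m) * c m ((z powi (int m - n)) *\<^sub>C rep_L2 f z)" for m z
  have bl: "bounded_linear (c m)" for m
    unfolding c_def by (rule taylor_coeff_bounded_linear[OF F])
  have int: "integrable circle_measure (\<phi> m)" for m
    unfolding \<phi>_def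
    by (intro integrable_mult_right integrable_bounded_linear[OF bl] integrable_powi_rep)
  have bound: "norm (\<phi> m z) \<le> q ^ m * (K * norm (rep_L2 f z))" if "cmod z = 1" for m z
  proof -
    have "norm (\<phi> m z) = r ^ m * cmod (c m ((z powi (int m - n)) *\<^sub>C rep_L2 f z))"
      using r by (simp add: \<phi>_def norm_mult norm_power)
    also have "\<dots> \<le> r ^ m * (B * norm ((z powi (int m - n)) *\<^sub>C rep_L2 f z) * norm y / R ^ m)"
      unfolding c_def using r by (intro mult_left_mono taylor_coeff_bound F B R) auto
    also have "\<dots> = q ^ m * (K * norm (rep_L2 f z))"
      using that by (simp add: norm_scaleC norm_power_int q_def K_def power_divide)
    finally show ?thesis .
  qed
  have int0: "integral\<^sup>L circle_measure (\<phi> m) = 0" for m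
  proof -
    have "integral\<^sup>L circle_measure (\<phi> m)
        = of_real (r ^ m) * (LINT z|circle_measure. c m ((z powi (int m - n)) *\<^sub>C rep_L2 f z))"
      unfolding \<phi>_def by simp
    also have "(LINT z|circle_measure. c m ((z powi (int m - n)) *\<^sub>C rep_L2 f z))
        = c m (fourier_coeff f (n - int m))"
      unfolding fourier_coeff_def minus_diff_eq
      by (rule integral_bounded_linear[OF bl integrable_powi_rep])
    also have "fourier_coeff f (n - int m) = 0"
      using f n by (simp add: H2_def)
    also have "c m 0 = 0"
      by (rule linear_0[OF bounded_linear.linear[OF bl]])
    finally show ?thesis by simp
  qed
  have sum_q: "summable (\<lambda>m. q ^ m * C)" for C :: real
    using q by (intro summable_mult2 summable_geometric) simp
  have "(LINT z|circle_measure. (\<Sum>m. \<phi> m z)) = (\<Sum>m. integral\<^sup>L circle_measure (\<phi> m))"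
  proof (rule integral_suminf[OF int])
    have "summable (\<lambda>m. norm (\<phi> m z))" if "cmod z = 1" for z
      by (rule summable_comparison_test_ev[OF _ sum_q[of "K * norm (rep_L2 f z)"]])
        (use bound[OF that] in simp)
    then show "AE z in circle_measure. summable (\<lambda>m. norm (\<phi> m z))"
      using AE_circle_norm by (rule eventually_mono[rotated])
    have fi: "integrable circle_measure (\<lambda>z. norm (rep_L2 f z))"
      by (intro integrable_norm square_integrable_imp_integrable square_integrable_rep)
    have "(LINT z|circle_measure. norm (\<phi> m z)) \<le> q ^ m * (K * (LINT z|circle_measure. norm (rep_L2 f z)))" for m
    proof -
      have "(LINT z|circle_measure. norm (\<phi> m z)) \<le> (LINT z|circle_measure. q ^ m * (K * norm (rep_L2 f z)))"
        by (rule integral_mono) (use int fi bound in simp_all)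
      then show ?thesis by simp
    qed
    then show "summable (\<lambda>m. LINT z|circle_measure. norm (\<phi> m z))"
      by (intro summable_comparison_test_ev
          [OF _ sum_q[of "K * (LINT z|circle_measure. norm (rep_L2 f z))"]]) (simp add: always_eventually)
  qed
  moreover have "(LINT z|circle_measure. z powi (- n) * cinner (F (r *\<^sub>R z) (rep_L2 f z)) y)
      = (LINT z|circle_measure. (\<Sum>m. \<phi> m z))"
  proof (rule integral_circle_cong)
    fix z :: complex assume z: "cmod z = 1"
    then have "z \<noteq> 0" by auto
    have "(\<lambda>m. c m (rep_L2 f z) * (r *\<^sub>R z) ^ m) sums cinner (F (r *\<^sub>R z) (rep_L2 f z)) y"
      unfolding c_def by (rule taylor_coeff_sums[OF F]) (use r z in simp)
    then have "(\<lambda>m. z powi (- n) * (c m (rep_L2 f z) * (r *\<^sub>R z) ^ m))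
        sums (z powi (- n) * cinner (F (r *\<^sub>R z) (rep_L2 f z)) y)"
      by (rule sums_mult)
    moreover have "z powi (- n) * (c m (rep_L2 f z) * (r *\<^sub>R z) ^ m) = \<phi> m z" for m
    proof -
      have "z powi (int m - n) = z ^ m * z powi (- n)"
        using \<open>z \<noteq> 0\<close> power_int_add[of z "int m" "- n"] by simp
      then show ?thesis
        by (simp add: \<phi>_def c_def taylor_coeff_scaleC[OF F] scaleR_conv_of_real power_mult_distrib)
    qed
    ultimately show "z powi (- n) * cinner (F (r *\<^sub>R z) (rep_L2 f z)) y = (\<Sum>m. \<phi> m z)"
      by (simp add: sums_iff)
  qed
  ultimately show ?thesis
    by (simp add: int0)
qed

text \<open>The negative coefficients vanish for every dilation, and dominated convergence along
  \<open>radii\<close> carries this to the boundary; the bound of \<open>F\<close> on the disc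
  supplies the majorant.\<close>

lemma mult_op_H2:
  assumes F: "inner_function F" and f: "f \<in> H2"
  shows "mult_op F f \<in> H2"
  unfolding H2_iff
proof (intro allI impI)
  fix n :: int and y :: 'a
  assume n: "n < 0"
  have FH: "F \<in> Hinf" using F by (simp add: inner_function_def)
  obtain B where B: "B \<ge> 0" "\<And>w x. cmod w < 1 \<Longrightarrow> norm (F w x) \<le> B * norm x"
    using Hinf_bound[OF FH] by blast
  have m: "(\<lambda>z. z powi (- n) * cinner (G z) y) \<in> borel_measurable circle_measure"
    if "G \<in> borel_measurable circle_measure" for G
    by (rule borel_measurable_times[OF borel_measurable_circle_continuous[OF continuous_on_circle_powi]
          borel_measurable_cinner[OF that borel_measurable_const]])
  have "cinner (mult_op F f) (monomial n y) = (LINT z|circle_measure. z powi (- n) * cinner (F z (rep_L2 f z)) y)"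
    unfolding cinner_rep
  proof (rule integral_cong_AE)
    show "AE z in circle_measure. cinner (rep_L2 (mult_op F f) z) (rep_L2 (monomial n y) z)
        = z powi (- n) * cinner (F z (rep_L2 f z)) y"
      using rep_monomial[of n y] rep_pointwise_map[OF pw_isometry_inner_function[OF F], of f] AE_circle_norm
      unfolding mult_op_def
      by eventually_elim (simp add: cinner_scaleC_right cnj_powi_circle del: complex_cnj_power_int)
    show "(\<lambda>z. z powi (- n) * cinner (F z (rep_L2 f z)) y) \<in> borel_measurable circle_measure"
      by (rule m[OF Hinf_boundary_measurable[OF FH rep_measurable]])
  qed (rule borel_measurable_cinner[OF rep_measurable rep_measurable])
  moreover have "(\<lambda>k. LINT z|circle_measure. z powi (- n) * cinner (F (radii k *\<^sub>R z) (rep_L2 f z)) y)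
      \<longlonglongrightarrow> (LINT z|circle_measure. z powi (- n) * cinner (F z (rep_L2 f z)) y)"
  proof (rule integral_dominated_convergence[where w = "\<lambda>z. B * norm y * norm (rep_L2 f z)"])
    show "(\<lambda>z. z powi (- n) * cinner (F z (rep_L2 f z)) y) \<in> borel_measurable circle_measure"
      by (rule m[OF Hinf_boundary_measurable[OF FH rep_measurable]])
    show "(\<lambda>z. z powi (- n) * cinner (F (radii k *\<^sub>R z) (rep_L2 f z)) y) \<in> borel_measurable circle_measure" for k
      by (rule m[OF Hinf_dilation_measurable[OF FH radii rep_measurable]])
    show "integrable circle_measure (\<lambda>z. B * norm y * norm (rep_L2 f z))"
      by (intro integrable_mult_right integrable_norm square_integrable_imp_integrable square_integrable_rep)
    show "AE z in circle_measure. (\<lambda>k. z powi (- n) * cinner (F (radii k *\<^sub>R z) (rep_L2 f z)) y)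
        \<longlonglongrightarrow> z powi (- n) * cinner (F z (rep_L2 f z)) y"
      using Hinf_radii[OF FH]
      by eventually_elim
        (intro tendsto_mult_left bounded_linear.tendsto[OF cinner.bounded_linear_left]
          bounded_linear.tendsto[OF blinfun.bounded_linear_left])
    show "AE z in circle_measure. norm (z powi (- n) * cinner (F (radii k *\<^sub>R z) (rep_L2 f z)) y)
        \<le> B * norm y * norm (rep_L2 f z)" for k
      using AE_circle_norm
    proof eventually_elim
      case (elim z)
      have "norm (z powi (- n) * cinner (F (radii k *\<^sub>R z) (rep_L2 f z)) y)
          = cmod (cinner (F (radii k *\<^sub>R z) (rep_L2 f z)) y)"
        using elim by (simp add: norm_mult norm_power_int)
      also have "\<dots> \<le> norm (F (radii k *\<^sub>R z) (rep_L2 f z)) * norm y"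
        by (rule cmod_cinner_le)
      also have "\<dots> \<le> (B * norm (rep_L2 f z)) * norm y"
        by (intro mult_right_mono B radii_scaleR_norm elim) simp
      finally show ?case by (simp add: mult_ac)
    qed
  qed
  ultimately show "cinner (mult_op F f) (monomial n y) = 0"
    by (simp add: integral_dilation_0[OF FH radii f n] LIMSEQ_const_iff)
qed

text \<open>A factorization in the disc reaches the circle, where the operators on \<open>L2\<close>
  live, through radial limits and continuity of composition.\<close>

lemma Hinf_boundary_compose:
  assumes "F \<in> Hinf" "G \<in> Hinf" "H \<in> Hinf" and eq: "\<forall>z\<in>ball 0 1. H z = F z o\<^sub>L G z"
  shows "AE z in circle_measure. H z = F z o\<^sub>L G z"
  using Hinf_radii[OF assms(1)] Hinf_radii[OF assms(2)] Hinf_radii[OF assms(3)] AE_circle_norm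
proof eventually_elim
  case (elim z)
  have "(\<lambda>n. F (radii n *\<^sub>R z) o\<^sub>L G (radii n *\<^sub>R z)) \<longlonglongrightarrow> (F z o\<^sub>L G z)"
    by (rule bounded_bilinear.tendsto[OF bounded_bilinear_blinfun_compose elim(1,2)])
  moreover have "F (radii n *\<^sub>R z) o\<^sub>L G (radii n *\<^sub>R z) = H (radii n *\<^sub>R z)" for n
    using eq radii_scaleR_norm[OF elim(4)] by simp
  ultimately show ?case
    using LIMSEQ_unique elim(3) by fastforce
qed


section \<open>Direct sums of conjugations\<close>

text \<open>\<open>subspace\<close> speaks of real scalars; this is its complex counterpart.\<close>

definition lincomb_closed :: "'a :: complex_inner set \<Rightarrow> bool" where
  "lincomb_closed M \<longleftrightarrow> (\<forall>f\<in>M. \<forall>g\<in>M. \<forall>a b. a *\<^sub>C f + b *\<^sub>C g \<in> M)"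

lemma lincomb_closedD: "lincomb_closed M \<Longrightarrow> f \<in> M \<Longrightarrow> g \<in> M \<Longrightarrow> a *\<^sub>C f + b *\<^sub>C g \<in> M"
  by (simp add: lincomb_closed_def)

lemma lincomb_closed_diff: "lincomb_closed M \<Longrightarrow> f \<in> M \<Longrightarrow> g \<in> M \<Longrightarrow> f - g \<in> M"
  using lincomb_closedD[of M f g 1 "- 1"] by (simp add: scaleC_one scaleC_minus_one)

text \<open>\<open>direct_sum_map\<close> is a definite description; orthogonality makes the
  decomposition unique and so determines its value.\<close>

lemma direct_sum_map_eq:
  assumes "lincomb_closed M" "lincomb_closed N"
    and orth: "\<And>u v. u \<in> M \<Longrightarrow> v \<in> N \<Longrightarrow> cinner u v = 0"
    and uv: "u \<in> M" "v \<in> N"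
  shows "direct_sum_map M N A B (u + v) = A u + B v"
  unfolding direct_sum_map_def
proof (rule the_equality)
  show "\<exists>u'\<in>M. \<exists>v'\<in>N. u + v = u' + v' \<and> A u + B v = A u' + B v'"
    using uv by blast
  fix h assume "\<exists>u'\<in>M. \<exists>v'\<in>N. u + v = u' + v' \<and> h = A u' + B v'"
  then obtain u' v' where h: "u' \<in> M" "v' \<in> N" "u + v = u' + v'" "h = A u' + B v'"
    by blast
  have eq: "u - u' = v' - v"
    using h(3) by (simp add: algebra_simps)
  \<comment> \<open>The common difference lies in \<open>M\<close> and in \<open>N\<close>, hence is
    orthogonal to itself.\<close>
  have "cinner (u - u') (v' - v) = 0"
    by (intro orth lincomb_closed_diff assms uv h)
  then have "u - u' = 0"
    unfolding eq by (simp add: cinner_self)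
  with eq h(4) show "h = A u + B v" by simp
qed

text \<open>Cross terms in the inner product vanish by orthogonality; the other laws hold summand by
  summand.\<close>

lemma conjugation_on_direct_sum:
  assumes M: "lincomb_closed M" and N: "lincomb_closed N"
    and orth: "\<And>u v. u \<in> M \<Longrightarrow> v \<in> N \<Longrightarrow> cinner u v = 0"
    and A: "conjugation_on M A" and B: "conjugation_on N B"
    and K: "K = {u + v |u v. u \<in> M \<and> v \<in> N}"
  shows "conjugation_on K (direct_sum_map M N A B)"
proof -
  let ?C = "direct_sum_map M N A B"
  have C: "?C (u + v) = A u + B v" if "u \<in> M" "v \<in> N" for u v
    by (rule direct_sum_map_eq[OF M N orth that])
  have orth': "cinner v u = 0" if "u \<in> M" "v \<in> N" for u v
    by (metis orth[OF that] cinner_commute complex_cnj_zero)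
  note AM = conjugation_onD(1)[OF A] and BN = conjugation_onD(1)[OF B]
  show ?thesis
    unfolding conjugation_on_def
  proof (intro conjI ballI allI)
    fix f assume "f \<in> K"
    then obtain u v where f: "f = u + v" "u \<in> M" "v \<in> N" using K by blast
    note AB = AM[OF f(2,2)] BN[OF f(3,3)]
    show "?C f \<in> K"
      unfolding f(1) C[OF f(2,3)] K using AB by blast
    show "?C (?C f) = f"
      unfolding f(1) C[OF f(2,3)] C[OF AB] conjugation_onD(3)[OF A f(2,2)] conjugation_onD(3)[OF B f(3,3)] ..
    fix g assume "g \<in> K"
    then obtain u' v' where g: "g = u' + v'" "u' \<in> M" "v' \<in> N" using K by blast
    note AB' = AM[OF g(2,2)] BN[OF g(3,3)]
    show "cinner (?C f) (?C g) = cinner g f"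
      unfolding f(1) g(1) C[OF f(2,3)] C[OF g(2,3)]
      using conjugation_onD(4)[OF A f(2) g(2)] conjugation_onD(4)[OF B f(3) g(3)] f g AB AB'
      by (simp add: cinner_add_left cinner_add_right orth orth')
    fix a b
    have "a *\<^sub>C f + b *\<^sub>C g = (a *\<^sub>C u + b *\<^sub>C u') + (a *\<^sub>C v + b *\<^sub>C v')"
      by (simp add: f g scaleC_add_right)
    then have "?C (a *\<^sub>C f + b *\<^sub>C g) = A (a *\<^sub>C u + b *\<^sub>C u') + B (a *\<^sub>C v + b *\<^sub>C v')"
      using C[OF lincomb_closedD[OF M f(2) g(2)] lincomb_closedD[OF N f(3) g(3)]] by simp
    also have "\<dots> = cnj a *\<^sub>C ?C f + cnj b *\<^sub>C ?C g"
      unfolding conjugation_onD(2)[OF A f(2) g(2)] conjugation_onD(2)[OF B f(3) g(3)] f(1) g(1)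
        C[OF f(2,3)] C[OF g(2,3)]
      by (simp add: scaleC_add_right)
    finally show "?C (a *\<^sub>C f + b *\<^sub>C g) = cnj a *\<^sub>C ?C f + cnj b *\<^sub>C ?C g" .
  qed
qed

text \<open>On the image of \<open>U\<close> the left inverse \<open>V\<close> undoes
  \<open>U\<close>, so every law reduces to the one for \<open>C\<close>. With multiplication by
  \<open>\<Lambda>\<close> and by its adjoint this gives the second summand.\<close>

lemma conjugation_on_transport:
  assumes C: "conjugation_on K C"
    and lin: "\<And>f g a b. U (a *\<^sub>C f + b *\<^sub>C g) = a *\<^sub>C U f + b *\<^sub>C U g"
    and iso: "\<And>f g. cinner (U f) (U g) = cinner f g"
    and inv: "\<And>f. V (U f) = f"
  shows "conjugation_on (U ` K) (U \<circ> C \<circ> V)"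
  unfolding conjugation_on_def
proof (intro conjI ballI allI)
  fix f assume "f \<in> U ` K"
  then obtain u where f: "f = U u" "u \<in> K" by blast
  show "(U \<circ> C \<circ> V) f \<in> U ` K"
    using conjugation_onD(1)[OF C f(2,2)] by (simp add: f(1) inv)
  show "(U \<circ> C \<circ> V) ((U \<circ> C \<circ> V) f) = f"
    using conjugation_onD(3)[OF C f(2,2)] by (simp add: f(1) inv)
  fix g assume "g \<in> U ` K"
  then obtain v where g: "g = U v" "v \<in> K" by blast
  show "cinner ((U \<circ> C \<circ> V) f) ((U \<circ> C \<circ> V) g) = cinner g f"
    using conjugation_onD(4)[OF C f(2) g(2)] by (simp add: f(1) g(1) inv iso)
  show "(U \<circ> C \<circ> V) (a *\<^sub>C f + b *\<^sub>C g) = cnj a *\<^sub>C (U \<circ> C \<circ> V) f + cnj b *\<^sub>C (U \<circ> C \<circ> V) g" for a b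
    by (simp add: f(1) g(1) inv lin[symmetric] conjugation_onD(2)[OF C f(2) g(2)])
qed


section \<open>Model spaces of symmetric inner functions\<close>

text \<open>The extra factor \<open>cnj z\<close> makes the index map \<open>n\<close> to
  \<open>- n - 1\<close>, which exchanges negative and nonnegative integers. The invariance of model
  spaces rests on this.\<close>

lemma cnj_times_powi:
  assumes "cmod z = 1"
  shows "cnj (z powi n) * cnj z = z powi (- n - 1)"
proof -
  have "z \<noteq> 0" using assms by auto
  then have "z powi (- n - 1) = z powi (- n) * z powi (- 1)"
    using power_int_add[of z "- n" "- 1"] by (simp del: power_int_minus1_right)
  moreover have "cnj z = z powi (- 1)"
    using cnj_powi_circle[OF assms, of 1] by simp
  ultimately show ?thesis
    using cnj_powi_circle[OF assms, of n] by simp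
qed

locale symmetric_inner = conjugation \<Gamma>
  for \<Gamma> :: "'h :: {complex_inner, euclidean_space} \<Rightarrow> 'h" +
  fixes \<Lambda> :: "complex \<Rightarrow> 'h \<Rightarrow>\<^sub>L 'h"
  assumes inner: "inner_function \<Lambda>" and symmetric: "Gamma_symmetric \<Gamma> \<Lambda>"
begin

abbreviation "U \<equiv> mult_op \<Lambda>"
abbreviation "V \<equiv> mult_op (\<lambda>z. adj (\<Lambda> z))"
abbreviation "C \<equiv> model_conj \<Gamma> \<Lambda>"
text \<open>The part of \<open>C\<close> that is independent of \<open>\<Lambda>\<close>:
  \<open>C\<close> is \<open>U\<close> after \<open>W\<close> by \<open>C_eq\<close>, so the
  isometry \<open>U\<close> can be cancelled.\<close>

abbreviation "W \<equiv> pointwise_map (\<lambda>z x. cnj z *\<^sub>C \<Gamma> x)"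

section \<open>Algebra of multiplication by \<Lambda> and of its conjugation\<close>

lemma AE_linear: "AE z in circle_measure. complex_linear (\<Lambda> z)"
  by (rule Hinf_boundary_linear) (use inner in \<open>simp add: inner_function_def\<close>)

lemma AE_unitary: "AE z in circle_measure. unitary (\<Lambda> z)"
  using inner by (simp add: inner_function_def)

lemma AE_symmetric: "AE z in circle_measure. \<forall>x. \<Gamma> (\<Lambda> z (\<Gamma> x)) = adj (\<Lambda> z) x"
  using symmetric by (simp add: Gamma_symmetric_def)

lemma pw_isometry_U: "pw_isometry (\<lambda>z. blinfun_apply (\<Lambda> z))"
  by (rule pw_isometry_inner_function[OF inner])

text \<open>Measurability of the adjoint comes from the symmetry: almost everywhere it is a
  composition of \<open>\<Gamma>\<close>, \<open>\<Lambda> z\<close> and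
  \<open>\<Gamma>\<close>.\<close>

lemma pw_isometry_V: "pw_isometry (\<lambda>z. blinfun_apply (adj (\<Lambda> z)))"
proof (rule pw_isometry_cong_AE)
  have G: "pw_isometry (\<lambda>z. \<Gamma>)"
    by (rule pw_isometry_conjugation) unfold_locales
  show "pw_isometry (\<lambda>z x. \<Gamma> (\<Lambda> z (\<Gamma> x)))"
    by (rule pw_isometry_compose[OF G pw_isometry_compose[OF pw_isometry_U G]])
qed (rule AE_symmetric)

lemma pw_isometry_W: "pw_isometry (\<lambda>z x. cnj z *\<^sub>C \<Gamma> x)"
proof (rule pw_isometry_compose[OF pw_isometry_scaleC])
  show "continuous_on (sphere 0 1) cnj"
    by (intro continuous_intros)
  show "pw_isometry (\<lambda>z. \<Gamma>)"
    by (rule pw_isometry_conjugation) unfold_locales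
qed simp

lemma pw_isometry_C: "pw_isometry (\<lambda>z x. \<Lambda> z (cnj z *\<^sub>C \<Gamma> x))"
  by (rule pw_isometry_compose[OF pw_isometry_U pw_isometry_W])

lemma rep_U: "AE z in circle_measure. rep_L2 (U f) z = \<Lambda> z (rep_L2 f z)"
  unfolding mult_op_def by (rule rep_pointwise_map[OF pw_isometry_U])

lemma rep_V: "AE z in circle_measure. rep_L2 (V f) z = adj (\<Lambda> z) (rep_L2 f z)"
  unfolding mult_op_def by (rule rep_pointwise_map[OF pw_isometry_V])

lemma rep_W: "AE z in circle_measure. rep_L2 (W f) z = cnj z *\<^sub>C \<Gamma> (rep_L2 f z)"
  by (rule rep_pointwise_map[OF pw_isometry_W])

lemma rep_C: "AE z in circle_measure. rep_L2 (C f) z = \<Lambda> z (cnj z *\<^sub>C \<Gamma> (rep_L2 f z))"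
  unfolding model_conj_def by (rule rep_pointwise_map[OF pw_isometry_C])

lemma rep_lincomb: "AE z in circle_measure. rep_L2 (a *\<^sub>C f + b *\<^sub>C g) z = a *\<^sub>C rep_L2 f z + b *\<^sub>C rep_L2 g z"
  using rep_add[of "a *\<^sub>C f" "b *\<^sub>C g"] rep_scaleC[of a f] rep_scaleC[of b g]
  by eventually_elim simp

lemma U_lincomb: "U (a *\<^sub>C f + b *\<^sub>C g) = a *\<^sub>C U f + b *\<^sub>C U g"
proof (rule L2_eqI)
  show "AE z in circle_measure. rep_L2 (U (a *\<^sub>C f + b *\<^sub>C g)) z = rep_L2 (a *\<^sub>C U f + b *\<^sub>C U g) z"
    using rep_U[of "a *\<^sub>C f + b *\<^sub>C g"] rep_lincomb[of a f b g] rep_lincomb[of a "U f" b "U g"]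
      rep_U[of f] rep_U[of g] AE_linear
    by eventually_elim (simp add: blinfun.add_right complex_linear_def)
qed

lemma V_U: "V (U f) = f"
proof (rule L2_eqI)
  show "AE z in circle_measure. rep_L2 (V (U f)) z = rep_L2 f z"
    using rep_V[of "U f"] rep_U[of f] AE_unitary
    by eventually_elim (simp add: unitary_adj_apply)
qed

lemma U_V: "U (V f) = f"
proof (rule L2_eqI)
  show "AE z in circle_measure. rep_L2 (U (V f)) z = rep_L2 f z"
    using rep_U[of "V f"] rep_V[of f] AE_unitary
    by eventually_elim (simp add: unitary_apply_adj)
qed

lemma cinner_U_left: "cinner (U f) g = cinner f (V g)"
proof (rule cinner_cong_AE)
  show "AE z in circle_measure. cinner (rep_L2 (U f) z) (rep_L2 g z) = cinner (rep_L2 f z) (rep_L2 (V g) z)"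
    using rep_U[of f] rep_V[of g] AE_linear
    by eventually_elim (simp add: cinner_adj)
qed

lemma cinner_U: "cinner (U f) (U g) = cinner f g"
  by (simp add: cinner_U_left V_U)

lemma C_eq: "C f = U (W f)"
proof (rule L2_eqI)
  show "AE z in circle_measure. rep_L2 (C f) z = rep_L2 (U (W f)) z"
    using rep_C[of f] rep_U[of "W f"] rep_W[of f]
    by eventually_elim simp
qed

lemma C_lincomb: "C (a *\<^sub>C f + b *\<^sub>C g) = cnj a *\<^sub>C C f + cnj b *\<^sub>C C g"
proof -
  have "W (a *\<^sub>C f + b *\<^sub>C g) = cnj a *\<^sub>C W f + cnj b *\<^sub>C W g"
  proof (rule L2_eqI)
    show "AE z in circle_measure. rep_L2 (W (a *\<^sub>C f + b *\<^sub>C g)) z = rep_L2 (cnj a *\<^sub>C W f + cnj b *\<^sub>C W g) z"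
      using rep_W[of "a *\<^sub>C f + b *\<^sub>C g"] rep_lincomb[of a f b g] rep_lincomb[of "cnj a" "W f" "cnj b" "W g"]
        rep_W[of f] rep_W[of g]
      by eventually_elim (simp add: add scale scaleC_add_right scaleC_scaleC mult.commute)
  qed
  then show ?thesis
    by (simp add: C_eq U_lincomb)
qed

text \<open>Symmetry turns the inner \<open>\<Lambda> z\<close> between two copies of
  \<open>\<Gamma>\<close> into its adjoint, which unitarity cancels against the outer one; the
  scalars cancel on the circle.\<close>

lemma C_C: "C (C f) = f"
proof (rule L2_eqI)
  show "AE z in circle_measure. rep_L2 (C (C f)) z = rep_L2 f z"
    using rep_C[of "C f"] rep_C[of f] AE_linear AE_unitary AE_symmetric AE_circle_norm
  proof eventually_elim
    case (elim z)
    let ?x = "rep_L2 f z"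
    have "cnj z * z = 1"
      using elim(6) complex_norm_square[of z] by (simp add: mult.commute)
    have "\<Gamma> (\<Lambda> z (cnj z *\<^sub>C \<Gamma> ?x)) = \<Gamma> (\<Lambda> z (\<Gamma> (z *\<^sub>C ?x)))"
      by (simp add: scale)
    also have "\<dots> = adj (\<Lambda> z) (z *\<^sub>C ?x)"
      using elim(5) by blast
    finally have "rep_L2 (C (C f)) z = \<Lambda> z (cnj z *\<^sub>C adj (\<Lambda> z) (z *\<^sub>C ?x))"
      using elim(1,2) by simp
    also have "\<dots> = cnj z *\<^sub>C \<Lambda> z (adj (\<Lambda> z) (z *\<^sub>C ?x))"
      using elim(3) by (simp add: complex_linear_def)
    also have "\<dots> = ?x"
      using \<open>cnj z * z = 1\<close> by (simp add: unitary_apply_adj[OF elim(4)] scaleC_scaleC scaleC_one)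
    finally show ?case .
  qed
qed

lemma cinner_C: "cinner (C f) (C g) = cinner g f"
proof -
  have "cinner (W f) (W g) = cinner g f"
  proof (rule cinner_cong_AE)
    show "AE z in circle_measure. cinner (rep_L2 (W f) z) (rep_L2 (W g) z) = cinner (rep_L2 g z) (rep_L2 f z)"
      using rep_W[of f] rep_W[of g] AE_circle_norm
    proof eventually_elim
      case (elim z)
      then have "z * cnj z = 1"
        using complex_norm_square[of z] by simp
      with elim show ?case
        by (simp add: cinner_scaleC_left cinner_scaleC_right cinner mult.assoc[symmetric] mult.commute)
    qed
  qed
  then show ?thesis
    by (simp add: C_eq cinner_U)
qed

text \<open>A conjugation reverses the arguments of the inner product, and the factor
  \<open>cnj z\<close> shifts the reflected index by 1.\<close>

lemma cinner_W_monomial: "cinner (W f) (monomial n y) = cinner (monomial (- n - 1) (\<Gamma> y)) f"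
proof (rule cinner_cong_AE)
  show "AE z in circle_measure. cinner (rep_L2 (W f) z) (rep_L2 (monomial n y) z)
      = cinner (rep_L2 (monomial (- n - 1) (\<Gamma> y)) z) (rep_L2 f z)"
    using rep_W[of f] rep_monomial[of n y] rep_monomial[of "- n - 1" "\<Gamma> y"] AE_circle_norm
  proof eventually_elim
    case (elim z)
    have "cinner (\<Gamma> (rep_L2 f z)) y = cinner (\<Gamma> y) (rep_L2 f z)"
      by (metis cinner idem)
    then show ?case
      unfolding elim(1-3)
      by (simp add: cinner_scaleC_left cinner_scaleC_right cnj_times_powi[OF elim(4)] mult.assoc[symmetric]
          del: complex_cnj_power_int)
  qed
qed

text \<open>Symmetry lets \<open>\<Lambda>\<close> pass through \<open>\<Gamma>\<close> as its
  adjoint, so that \<open>\<Lambda>\<close> ends up on the reflected monomial.\<close>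

lemma cinner_C_monomial: "cinner (C f) (monomial n y) = cinner (U (monomial (- n - 1) (\<Gamma> y))) f"
proof -
  have "cinner (C f) (monomial n y) = cinner (W f) (V (monomial n y))"
    by (simp add: C_eq cinner_U_left)
  also have "\<dots> = cinner (monomial (- n - 1) (\<Gamma> y)) (V f)"
  proof (rule cinner_cong_AE)
    show "AE z in circle_measure. cinner (rep_L2 (W f) z) (rep_L2 (V (monomial n y)) z)
        = cinner (rep_L2 (monomial (- n - 1) (\<Gamma> y)) z) (rep_L2 (V f) z)"
      using rep_W[of f] rep_V[of "monomial n y"] rep_monomial[of n y] rep_V[of f]
        rep_monomial[of "- n - 1" "\<Gamma> y"] AE_circle_norm AE_linear AE_symmetric
    proof eventually_elim
      case (elim z)
      let ?x = "rep_L2 f z"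
      have sym: "\<Lambda> z (\<Gamma> x) = \<Gamma> (adj (\<Lambda> z) x)" for x
        using elim(8) by (metis idem)
      have "cinner (\<Gamma> ?x) (adj (\<Lambda> z) (z powi n *\<^sub>C y)) = cinner (\<Lambda> z (\<Gamma> ?x)) (z powi n *\<^sub>C y)"
        by (rule cinner_adj[OF elim(7), symmetric])
      also have "\<dots> = cnj (z powi n) * cinner (\<Gamma> (adj (\<Lambda> z) ?x)) (\<Gamma> (\<Gamma> y))"
        by (simp add: sym cinner_scaleC_right idem)
      also have "cinner (\<Gamma> (adj (\<Lambda> z) ?x)) (\<Gamma> (\<Gamma> y)) = cinner (\<Gamma> y) (adj (\<Lambda> z) ?x)"
        by (rule cinner)
      finally show ?case
        unfolding elim(1-5) cinner_scaleC_left
        by (simp add: cnj_times_powi[OF elim(6), symmetric] del: complex_cnj_power_int)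
    qed
  qed
  finally show ?thesis
    by (simp add: cinner_U_left)
qed

section \<open>Invariance of the model space under the conjugation\<close>

lemma U_H2: "f \<in> H2 \<Longrightarrow> U f \<in> H2"
  by (rule mult_op_H2[OF inner])

lemma model_space_iff: "f \<in> model_space \<Lambda> \<longleftrightarrow> f \<in> H2 \<and> (\<forall>h\<in>H2. cinner f (U h) = 0)"
  by (auto simp: model_space_def orth_minus_def)

lemma lincomb_closed_model_space: "lincomb_closed (model_space \<Lambda>)"
  by (auto simp: lincomb_closed_def model_space_iff H2_lincomb cinner_add_left cinner_scaleC_left)

lemma C_model_space:
  assumes "f \<in> model_space \<Lambda>"
  shows "C f \<in> model_space \<Lambda>"
proof -
  have f: "f \<in> H2" and orth: "\<And>h. h \<in> H2 \<Longrightarrow> cinner f (U h) = 0"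
    using assms by (auto simp: model_space_iff)
  have "C f \<in> H2"
    unfolding H2_iff cinner_C_monomial
  proof (intro allI impI)
    fix n :: int and y assume "n < 0"
    \<comment> \<open>For \<open>n < 0\<close> the reflected index \<open>- n - 1\<close> is
      nonnegative.\<close>
    then have "cinner f (U (monomial (- n - 1) (\<Gamma> y))) = 0"
      by (intro orth monomial_in_H2) simp
    then show "cinner (U (monomial (- n - 1) (\<Gamma> y))) f = 0"
      by (metis cinner_commute complex_cnj_zero)
  qed
  \<comment> \<open>Cancelling \<open>U\<close> leaves \<open>W f\<close>. Its coefficients with
    index \<open>n \<ge> 0\<close> pair \<open>f\<close> with monomials of index
    \<open>- n - 1 < 0\<close>, to which \<open>f\<close> is orthogonal.\<close>
  moreover have "cinner (C f) (U h) = 0" if "h \<in> H2" for h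
    unfolding C_eq cinner_U
  proof (rule orthogonal_H2_if_orthogonal_monomials[OF _ that])
    fix n :: int assume "n \<ge> 0"
    then have "cinner f (monomial (- n - 1) (\<Gamma> y)) = 0" for y
      using f by (simp add: H2_iff)
    then show "fourier_coeff (W f) n = 0"
      unfolding fourier_coeff_eq_0_iff cinner_W_monomial
      by (metis cinner_commute complex_cnj_zero)
  qed
  ultimately show ?thesis
    by (simp add: model_space_iff)
qed

lemma conjugation_on_model_space: "conjugation_on (model_space \<Lambda>) C"
  unfolding conjugation_on_def by (simp add: C_model_space C_lincomb C_C cinner_C)

end

section \<open>Decomposition of the model space of a product\<close>

lemma model_space_mult:
  assumes L: "symmetric_inner \<Gamma> \<Lambda>" and P: "symmetric_inner \<Gamma> \<Psi>"
    and T: "symmetric_inner \<Gamma> \<Theta>" and eq: "AE z in circle_measure. \<Theta> z = \<Lambda> z o\<^sub>L \<Psi> z"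
  shows "model_space \<Theta> = {u + v |u v. u \<in> model_space \<Lambda> \<and> v \<in> mult_op \<Lambda> ` model_space \<Psi>}"
proof -
  interpret L: symmetric_inner \<Gamma> \<Lambda> by fact
  interpret P: symmetric_inner \<Gamma> \<Psi> by fact
  interpret T: symmetric_inner \<Gamma> \<Theta> by fact
  have TLP: "T.U f = L.U (P.U f)" for f
  proof (rule L2_eqI)
    show "AE z in circle_measure. rep_L2 (T.U f) z = rep_L2 (L.U (P.U f)) z"
      using T.rep_U[of f] L.rep_U[of "P.U f"] P.rep_U[of f] eq
      by eventually_elim simp
  qed
  show ?thesis
  proof (intro set_eqI iffI)
    fix f assume "f \<in> model_space \<Theta>"
    then have f: "f \<in> H2" "\<And>h. h \<in> H2 \<Longrightarrow> cinner f (T.U h) = 0"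
      by (auto simp: T.model_space_iff)
    obtain w where w: "w \<in> H2" "\<And>s. s \<in> H2 \<Longrightarrow> cinner (L.V f - w) s = 0"
      using H2_projection[of "L.V f"] by blast
    define u where "u = f - L.U w"
    \<comment> \<open>\<open>L.V f - w\<close> is orthogonal to \<open>H2\<close>, and the isometry
      \<open>L.U\<close> carries this over to \<open>u\<close>.\<close>
    have uL: "cinner u (L.U h) = 0" if "h \<in> H2" for h
    proof -
      have "cinner f (L.U h) = cinner (L.V f) h"
        by (metis L.cinner_U L.U_V)
      then show ?thesis
        using w(2)[OF that] by (simp add: u_def cinner.diff_left L.cinner_U)
    qed
    have "u \<in> H2"
      unfolding u_def by (rule subspace_diff[OF subspace_H2 f(1) L.U_H2[OF w(1)]])
    with uL have "u \<in> model_space \<Lambda>"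
      by (simp add: L.model_space_iff)
    moreover have "cinner w (P.U h) = 0" if "h \<in> H2" for h
    proof -
      \<comment> \<open>Applying \<open>L.U\<close> to both arguments turns \<open>w\<close> into
        \<open>f - u\<close> and \<open>P.U h\<close> into \<open>T.U h\<close>. Both
        \<open>f\<close> and \<open>u\<close> are orthogonal to the latter, \<open>u\<close> because
        \<open>P.U h \<in> H2\<close>.\<close>
      have "cinner w (P.U h) = cinner (f - u) (T.U h)"
        by (simp add: u_def TLP L.cinner_U)
      also have "\<dots> = 0"
        using f(2)[OF that] uL[OF P.U_H2[OF that]] by (simp add: cinner.diff_left TLP)
      finally show ?thesis .
    qed
    with w(1) have "w \<in> model_space \<Psi>"
      by (simp add: P.model_space_iff)
    moreover have "f = u + L.U w"
      by (simp add: u_def)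
    ultimately show "f \<in> {u + v |u v. u \<in> model_space \<Lambda> \<and> v \<in> L.U ` model_space \<Psi>}"
      by blast
  next
    fix f assume "f \<in> {u + v |u v. u \<in> model_space \<Lambda> \<and> v \<in> L.U ` model_space \<Psi>}"
    then obtain u w where f: "f = u + L.U w" "u \<in> model_space \<Lambda>" "w \<in> model_space \<Psi>"
      by blast
    then have "f \<in> H2"
      using L.U_H2 by (auto simp: L.model_space_iff P.model_space_iff intro: subspace_add[OF subspace_H2])
    \<comment> \<open>\<open>T.U h\<close> is \<open>L.U (P.U h)\<close>. The summand
      \<open>u\<close> is orthogonal to it since \<open>P.U h \<in> H2\<close>; for
      \<open>L.U w\<close> the isometry cancels and leaves \<open>w\<close> against
      \<open>P.U h\<close>.\<close>
    moreover have "cinner f (T.U h) = 0" if "h \<in> H2" for h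
      using f(2,3) that P.U_H2[OF that]
      by (simp add: f(1) TLP cinner_add_left L.cinner_U L.model_space_iff P.model_space_iff)
    ultimately show "f \<in> model_space \<Theta>"
      by (simp add: T.model_space_iff)
  qed
qed

section \<open>The direct sum conjugation on the model space of the product\<close>

theorem theorem4p1:
  fixes \<Gamma> :: "'h :: {complex_inner, euclidean_space} \<Rightarrow> 'h"
    and \<Theta> \<Lambda> \<Psi> :: "complex \<Rightarrow> 'h \<Rightarrow>\<^sub>L 'h"
  assumes "conjugation_on UNIV \<Gamma>"
    and "inner_function \<Theta>" and "inner_function \<Lambda>" and "inner_function \<Psi>"
    and "Gamma_symmetric \<Gamma> \<Theta>" and "Gamma_symmetric \<Gamma> \<Lambda>" and "Gamma_symmetric \<Gamma> \<Psi>"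
    and "\<forall>z\<in>ball 0 1. \<Theta> z = \<Lambda> z o\<^sub>L \<Psi> z"
  shows "conjugation_on (model_space \<Theta>) (factor_conj \<Gamma> \<Lambda> \<Psi>)"
proof -
  interpret L: symmetric_inner \<Gamma> \<Lambda> by unfold_locales fact+
  interpret P: symmetric_inner \<Gamma> \<Psi> by unfold_locales fact+
  interpret T: symmetric_inner \<Gamma> \<Theta> by unfold_locales fact+
  have "AE z in circle_measure. \<Theta> z = \<Lambda> z o\<^sub>L \<Psi> z"
    using assms by (intro Hinf_boundary_compose) (auto simp: inner_function_def)
  note K = model_space_mult[OF L.symmetric_inner_axioms P.symmetric_inner_axioms T.symmetric_inner_axioms this]
  show ?thesis
    unfolding factor_conj_def
  proof (rule conjugation_on_direct_sum[OF L.lincomb_closed_model_space _ _ L.conjugation_on_model_space _ K])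
    show "lincomb_closed (L.U ` model_space \<Psi>)"
      unfolding lincomb_closed_def
      using P.lincomb_closed_model_space by (auto simp: L.U_lincomb[symmetric] lincomb_closed_def)
    \<comment> \<open>\<open>v\<close> is \<open>L.U\<close> of an element of \<open>H2\<close>, so
      the orthogonality is part of \<open>u \<in> model_space \<Lambda>\<close>.\<close>
    show "cinner u v = 0" if "u \<in> model_space \<Lambda>" "v \<in> L.U ` model_space \<Psi>" for u v
      using that by (auto simp: L.model_space_iff P.model_space_iff)
    show "conjugation_on (L.U ` model_space \<Psi>) (L.U \<circ> P.C \<circ> L.V)"
      by (rule conjugation_on_transport[OF P.conjugation_on_model_space L.U_lincomb L.cinner_U L.V_U])
  qed
qed

end
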